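(* Consider the Vantage protocol specified in the context. Suppose every party is correct and each party places arriving transactions in a new valid data block and publishes it at once. Suppose the execution is in a non-Zeno responsive suffix beginning at a view $r$ past the all-correct pacemaker cutoff: every view below $r$ has already been proposed, and sealed and fully output at every correct party, by $\beta_r$, where $\beta_v$ denotes the send time of the view-$v$ proposal $B_v$. Then a transaction arriving at time $t\ge\beta_r$ is sequenced within \[ L_{\mathrm{tip}}\le\delta+\delta+2\delta=4\delta, \] and, ignoring tips, within \[ L_{\mathrm{core}}\le\delta+\delta+2\delta+\delta+2\delta=7\delta . \] If the next prefix-extending proposal opportunity is sent at time $t+\delta$ after processing the new block, the tip path is aligned and sequences it by $t+3\delta$. If an anchoring proposal is sent at $t+\delta$ after processing the new block and a later prefix-extending proposal is sent at $t+3\delta$ after processing its ECHO acknowledgment quorum, the core path is aligned and sequences it by $t+5\delta$ through the fast seal, or by $t+6\delta$ through the Direct AGB READY path. Over any finite union of complete responsive-opportunity intervals, if the eligibility time is wall-clock-uniform and independent of the fixed proposal schedule, the expected wait for the next prefix-extending opportunity is at most $\delta/2$. Under this additional convention, \[ \mathbf E[L_{\mathrm{tip}}]\le\delta+\tfrac{\delta}{2}+2\delta=3.5\delta,\qquad \mathbf E[L_{\mathrm{core}}]\le\delta+\tfrac{\delta}{2}+2\delta+\delta+2\delta=6.5\delta . \]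
   Context: Model. Parties $p_1,\dots,p_n$, $n\ge3f+1$; here all are correct. $Q=n-f$. Reliable authenticated point-to-point channels; a broadcast includes the sender, which delivers to itself immediately. All counts are over distinct authors of messages received directly from those authors. Partial synchrony: with unknown GST, a message sent at time $t$ arrives by $\max(t,\mathrm{GST})+\delta$, where $\delta\le\Delta$ and $\Delta$ is known. After GST local clocks measure elapsed real time without drift. At a local deadline a party processes every message delivered by that deadline, and evaluates the positive rules they enable, before taking the timeout rule. Executions are fair and non-Zeno (finitely many events in finite time). Data. Each party $p_a$ publishes valid hash-linked blocks (heights $1,2,\dots$) on its own unforked lane by $\mathsf{publish}$ messages to all. A reference $(a,k,h)$ names the block of height $k$ with hash $h$ and its whole lane prefix. $\mathsf{DirectPub}_j(a,k,h)$: $p_j$ holds the valid lane prefix ending at $h$ and received all its blocks in $\mathsf{publish}$ messages directly from $p_a$. Each proposal ECHO of $p_i$ carries, for every named reference $(a,k,h)$, an exact-position bit iff $\mathsf{DirectPub}_i(a,k,h)$, or otherwise an integer locating the greatest directly published ancestor. A receiver counts an exact bit as an acknowledgment by the sender of $(a,k,h)$ and (after verifying the chain) its ancestors, an integer claim as one of the indicated ancestor and its ancestors. A reference is $q$-available at a party that has counted acknowledgments of it from $q$ parties; exact-$q$-available if all came from exact-position bits for that reference. $\mathsf{AuthorOK}_j$: $\mathsf{DirectPub}_j$ or $(f+1)$-available at $p_j$; for a manifest, every entry. Tip anchoring of $(C,T)$ at $p_i$: for every author present in both manifests, $p_i$ holds the full lane prefix of the tip entry and it strictly contains the author's core entry.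 Proposals. $\mathsf{Proposer}(v)=p_{1+((v-1)\bmod n)}$ sends one proposal $B_v=(C,T)$, each manifest with at most one reference per author. The core lists, per author, the newest (greatest height) directly published reference that is exact-$Q$-available at the proposer; the tip lists, per (non-quarantined) author, the least-height directly published prefix strictly above its core entry (genesis if none) that is $Q$-available but not exact-$Q$-available, if any, and otherwise the newest directly published lane tip strictly extending the core entry. (An author is quarantined at a party only after a proposal completes there with neither READY grade at quorum while that author's tip entry is not exact-$Q$-available.) Direct AGB in view $v$. $\mathsf{CoreOK}_i(C)=\mathsf{AuthorOK}_i(C)$; $\mathsf{TipOK}_i(C,T)$ is $\mathsf{AuthorOK}_i(T)$ plus tip anchoring. $\theta_E=3\Delta$, $\theta_R=4\Delta$; $e_i(v)$ is $p_i$'s entry time. (R2) $p_i$ fixes the first view-$v$ proposal received directly from the proposer. A fixed well-formed proposal is active once $p_i$ activates or enters $v$. While its echo-stage response is pending and the proposal is active, as soon as $\mathsf{CoreOK}_i(C)$ and $\mathsf{TipOK}_i(C,T)$ hold it broadcasts a grade-1 ECHO. After entry, with $t$ the later of entry and direct receipt, if nothing was sent by the end of $[t,\min\{t+\Delta,e_i(v)+\theta_E\}]$ it broadcasts a grade-0 ECHO if $\mathsf{CoreOK}_i(C)$ holds and $\mathsf{echo\text{-}skip}$ otherwise. If no well-formed proposal is active by $e_i(v)+\theta_E$ it broadcasts $\mathsf{echo\text{-}skip}$. One echo-stage response per view. (R3) Independently of entry, while its initial ready-stage response is pending: upon counting $Q$ ECHOs (any grades) naming one $B$, $p_i$ broadcasts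 READY for $B$ with grade 1 (resp. 0) if it has counted $Q$ grade-1 (resp. grade-0) ECHOs for $B$, and grade mix otherwise (refinable once to a homogeneous grade before all $n$ echo-stage responses are counted and before $e_i(v)+\theta_R$). If it has entered and sent no READY by $e_i(v)+\theta_R$ it broadcasts $\mathsf{no\text{-}ready}$. (R4) Upon counting $Q$ READYs for a common $B=(C,T)$, $p_i$ completes $v$; $Q$ grade-1 READYs for $B$ seal $v$ as $\mathsf{commit\text{-}full}(C,T)$ (READY path); $Q$ grade-0 ones seal it as $\mathsf{commit\text{-}core}(C)$. Fast seal: a party that has counted grade-1 ECHOs for one $B=(C,T)$ from all $n$ parties seals $v$ as $\mathsf{commit\text{-}full}(C,T)$. The first seal is kept. Pacemaker. $p_i$ stores the largest directly received WISH value $\omega_i[j]$ of each $p_j$ (initially 0); $\omega_i^+$ and $\omega_i^Q$ are the $(f+1)$st and $Q$th largest entries. Genesis enters view 1 and broadcasts WISH 2; responses for views $\le0$ are fixed. When $\omega_i^+$ exceeds its own largest wish, $p_i$ broadcasts a WISH for $\omega_i^+$; when $\omega_i^Q$ increases it enters all missing views up to $\omega_i^Q$ immediately in order. Before sending whichever of its echo-stage response for $v-1$ and initial ready-stage response for $v-2$ completes that pair, $p_i$ raises its own wish to at least $v+1$. Responsive frontier $a_i$, initially 0: entering $v$ raises $a_i$ to at least $v-1$; when the fixed proposal of view $a_i+1$ is well formed, $a_i$ increases by one and that view is activated (repeatedly, in order). $\mathsf{Proposer}(v)$ broadcasts its proposal once, as soon as $a_i\ge v-1$ or $\omega_i^+\ge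 v$. Terms. All-correct pacemaker cutoff: a finite view $V$, larger than every view entered, proposed, responded to or wished for before GST, such that for all $v\ge V$ every party enters $v$ within $\delta$ of the first entry to $v$; past the cutoff means $v\ge V$. $B_v$ is prefix-extending if every lower view's proposal was sent by $\beta_v$. Sequenced (at every correct party): views are processed in increasing order; once all earlier views are sealed and output, a sealed-full view appends the (not yet output) blocks of the lane prefixes named by its core and then its tip; a block is sequenced when so appended. $L_{\mathrm{tip}}$ and $L_{\mathrm{core}}$ are the times from arrival to sequencing when the block may be covered by a proposal's core or tip, respectively only by a proposal's core. An anchoring proposal is a proposal naming in its tip a reference covering the block. The eligibility time is the time from which proposers may cover the block (on the tip path, all have received it directly; on the core path, the eligibility for the anchoring proposal). The chronological sends that fill the least not-yet-proposed view are $S_1<S_2<\cdots$ (the prefix-extending, or fresh, opportunities); the responsive-opportunity intervals are $[S_j,S_{j+1})$.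
   Formalization: Added: at the relevant opportunity the author is not quarantined and no older Q-available, not exact-Q-available tip is preferred, unless the core covers the block; for the 7δ and 6.5δ bounds, a newer tip with no core entry for its author must get Q exact acknowledgments. Otherwise the bounds can fail. *)

theory Defs
  imports "HOL-Probability.Probability"
begin

section \<open>Data and messages\<close>

text \<open>Parties are the naturals \<open>1..n\<close>.  The parent of a height-1 block is \<open>None\<close>.\<close>

datatype ('tx, 'h) block =
  Block (author: nat) (height: nat) (parent: "'h option") (txs: "'tx list")

datatype 'h ref = Ref (rauthor: nat) (rheight: nat) (rhash: 'h)

type_synonym 'h manifest = "'h ref set"

type_synonym 'h proposal = "'h manifest \<times> 'h manifest"

datatype claim = Exact | Upto nat

datatype grade = G0 | G1 | GMix

datatype ('tx, 'h) msg =
    Publish "('tx, 'h) block"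
  | Proposal nat "'h proposal"
  | Echo nat grade "'h proposal" "('h ref \<times> claim) set"
  | Echo_Skip nat
  | Ready nat grade "'h proposal"
  | No_Ready nat
  | Wish nat

text \<open>\<open>Arrive a tx\<close>: a transaction arrives at \<open>a\<close>.  \<open>Bcast i m\<close>: \<open>i\<close> broadcasts \<open>m\<close>.
  \<open>Deliver i j m\<close>: \<open>i\<close> receives and processes \<open>m\<close>, sent by \<open>j \<noteq> i\<close>; a party's own broadcasts need
  no delivery event (see \<open>receives\<close>).  \<open>Enter i v\<close>: \<open>i\<close> enters view \<open>v\<close>.\<close>

datatype ('tx, 'h) event =
    Arrive nat 'tx
  | Bcast nat "('tx, 'h) msg"
  | Deliver nat nat "('tx, 'h) msg"
  | Enter nat nat

text \<open>An execution is an infinite sequence of events \<open>ev 0, ev 1, \<dots>\<close>, the \<open>k\<close>-th happening at real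
  time \<open>tm k\<close>; the index orders simultaneous events.  Predicates with a final argument \<open>k\<close> describe
  the situation after the events with index less than \<open>k\<close>.  \<open>clock i\<close> maps real time to the local
  clock of \<open>i\<close>.  \<open>quarantined i a k\<close>: party \<open>i\<close> quarantines author \<open>a\<close> at position \<open>k\<close>; it is part of
  the execution because the protocol fixes only a necessary condition for it.\<close>

record ('tx, 'h) execution =
  nparties :: nat
  nfaulty :: nat
  delta :: real
  Delta :: real
  gst :: real
  hash :: "('tx, 'h) block \<Rightarrow> 'h"
  clock :: "nat \<Rightarrow> real \<Rightarrow> real"
  ev :: "nat \<Rightarrow> ('tx, 'h) event"
  tm :: "nat \<Rightarrow> real"
  quarantined :: "nat \<Rightarrow> nat \<Rightarrow> nat \<Rightarrow> bool"

definition parties :: "('tx, 'h) execution \<Rightarrow> nat set" where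
  "parties E = {1..nparties E}"

definition quorum :: "('tx, 'h) execution \<Rightarrow> nat" where
  "quorum E = nparties E - nfaulty E"

definition proposer :: "('tx, 'h) execution \<Rightarrow> nat \<Rightarrow> nat" where
  "proposer E v = 1 + (v - 1) mod nparties E"

definition sent :: "('tx, 'h) execution \<Rightarrow> nat \<Rightarrow> ('tx, 'h) msg \<Rightarrow> nat \<Rightarrow> bool" where
  "sent E i m k \<longleftrightarrow> (\<exists>k'<k. ev E k' = Bcast i m)"

definition receives :: "('tx, 'h) execution \<Rightarrow> nat \<Rightarrow> nat \<Rightarrow> ('tx, 'h) msg \<Rightarrow> nat \<Rightarrow> bool" where
  "receives E i j m k \<longleftrightarrow> ev E k = Deliver i j m \<or> (i = j \<and> ev E k = Bcast i m)"

definition rcvd :: "('tx, 'h) execution \<Rightarrow> nat \<Rightarrow> nat \<Rightarrow> ('tx, 'h) msg \<Rightarrow> nat \<Rightarrow> bool" where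
  "rcvd E i j m k \<longleftrightarrow> (\<exists>k'<k. receives E i j m k')"

definition entered :: "('tx, 'h) execution \<Rightarrow> nat \<Rightarrow> nat \<Rightarrow> nat \<Rightarrow> bool" where
  "entered E i v k \<longleftrightarrow> (\<exists>k'<k. ev E k' = Enter i v)"


section \<open>Lanes, availability and manifests\<close>

definition lane_prefix ::
  "('tx, 'h) execution \<Rightarrow> 'h ref \<Rightarrow> ('tx, 'h) block list \<Rightarrow> bool" where
  "lane_prefix E \<rho> bs \<longleftrightarrow>
     bs \<noteq> [] \<and> length bs = rheight \<rho> \<and> hash E (last bs) = rhash \<rho> \<and>
     (\<forall>l<length bs. author (bs ! l) = rauthor \<rho> \<and> height (bs ! l) = Suc l \<and>
        parent (bs ! l) = (if l = 0 then None else Some (hash E (bs ! (l - 1)))))"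

definition block_ref :: "('tx, 'h) execution \<Rightarrow> ('tx, 'h) block \<Rightarrow> 'h ref" where
  "block_ref E b = Ref (author b) (height b) (hash E b)"

definition holds_prefix ::
  "('tx, 'h) execution \<Rightarrow> nat \<Rightarrow> 'h ref \<Rightarrow> ('tx, 'h) block list \<Rightarrow> nat \<Rightarrow> bool" where
  "holds_prefix E i \<rho> bs k \<longleftrightarrow>
     lane_prefix E \<rho> bs \<and> (\<forall>b\<in>set bs. \<exists>j\<in>parties E. rcvd E i j (Publish b) k)"

definition holds :: "('tx, 'h) execution \<Rightarrow> nat \<Rightarrow> 'h ref \<Rightarrow> nat \<Rightarrow> bool" where
  "holds E i \<rho> k \<longleftrightarrow> (\<exists>bs. holds_prefix E i \<rho> bs k)"

definition direct_pub :: "('tx, 'h) execution \<Rightarrow> nat \<Rightarrow> 'h ref \<Rightarrow> nat \<Rightarrow> bool" where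
  "direct_pub E i \<rho> k \<longleftrightarrow>
     (\<exists>bs. lane_prefix E \<rho> bs \<and> (\<forall>b\<in>set bs. rcvd E i (rauthor \<rho>) (Publish b) k))"

text \<open>\<open>ancestor E i \<sigma> \<rho> k\<close>: \<open>i\<close> has verified the chain of \<open>\<rho>\<close> and \<open>\<sigma>\<close> is \<open>\<rho>\<close> or an ancestor of it.\<close>

definition ancestor :: "('tx, 'h) execution \<Rightarrow> nat \<Rightarrow> 'h ref \<Rightarrow> 'h ref \<Rightarrow> nat \<Rightarrow> bool" where
  "ancestor E i \<sigma> \<rho> k \<longleftrightarrow>
     (\<exists>bs. holds_prefix E i \<rho> bs k \<and> rauthor \<sigma> = rauthor \<rho> \<and> rheight \<sigma> \<le> rheight \<rho> \<and>
           lane_prefix E \<sigma> (take (rheight \<sigma>) bs))"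

text \<open>\<open>covers E \<rho> b\<close>: \<open>b\<close> lies on the published lane prefix named by \<open>\<rho>\<close>.\<close>

definition covers :: "('tx, 'h) execution \<Rightarrow> 'h ref \<Rightarrow> ('tx, 'h) block \<Rightarrow> bool" where
  "covers E \<rho> b \<longleftrightarrow>
     (\<exists>bs. lane_prefix E \<rho> bs \<and> b \<in> set bs \<and>
           (\<forall>b'\<in>set bs. \<exists>k. ev E k = Bcast (rauthor \<rho>) (Publish b')))"

text \<open>The integer in an \<open>Upto\<close> claim is the height of the greatest directly published ancestor
  (0 if there is none).  The sender need not hold the named chain; as lanes are unforked, the ancestor
  is determined by author and height.\<close>

definition claims ::
  "('tx, 'h) execution \<Rightarrow> nat \<Rightarrow> 'h proposal \<Rightarrow> nat \<Rightarrow> ('h ref \<times> claim) set" where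
  "claims E i B k =
     (\<lambda>\<rho>. (\<rho>, if direct_pub E i \<rho> k then Exact
              else Upto (Max ({0} \<union> {rheight \<sigma> | \<sigma>. rauthor \<sigma> = rauthor \<rho> \<and>
                                       rheight \<sigma> < rheight \<rho> \<and> direct_pub E i \<sigma> k}))))
     ` (fst B \<union> snd B)"

definition exact_ack ::
  "('tx, 'h) execution \<Rightarrow> nat \<Rightarrow> nat \<Rightarrow> 'h ref \<Rightarrow> nat \<Rightarrow> bool" where
  "exact_ack E i j \<rho> k \<longleftrightarrow>
     (\<exists>v g B cl. rcvd E i j (Echo v g B cl) k \<and> (\<rho>, Exact) \<in> cl)"

definition ack :: "('tx, 'h) execution \<Rightarrow> nat \<Rightarrow> nat \<Rightarrow> 'h ref \<Rightarrow> nat \<Rightarrow> bool" where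
  "ack E i j \<rho> k \<longleftrightarrow>
     exact_ack E i j \<rho> k \<or>
     (\<exists>v g B cl \<sigma> c. rcvd E i j (Echo v g B cl) k \<and> (\<sigma>, c) \<in> cl \<and> ancestor E i \<rho> \<sigma> k \<and>
        (case c of Exact \<Rightarrow> True | Upto m \<Rightarrow> rheight \<rho> \<le> m))"

definition available :: "('tx, 'h) execution \<Rightarrow> nat \<Rightarrow> nat \<Rightarrow> 'h ref \<Rightarrow> nat \<Rightarrow> bool" where
  "available E q i \<rho> k \<longleftrightarrow> q \<le> card {j \<in> parties E. ack E i j \<rho> k}"

definition exact_available ::
  "('tx, 'h) execution \<Rightarrow> nat \<Rightarrow> nat \<Rightarrow> 'h ref \<Rightarrow> nat \<Rightarrow> bool" where
  "exact_available E q i \<rho> k \<longleftrightarrow> q \<le> card {j \<in> parties E. exact_ack E i j \<rho> k}"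

definition author_ok :: "('tx, 'h) execution \<Rightarrow> nat \<Rightarrow> 'h ref \<Rightarrow> nat \<Rightarrow> bool" where
  "author_ok E i \<rho> k \<longleftrightarrow> direct_pub E i \<rho> k \<or> available E (nfaulty E + 1) i \<rho> k"

definition core_ok :: "('tx, 'h) execution \<Rightarrow> nat \<Rightarrow> 'h manifest \<Rightarrow> nat \<Rightarrow> bool" where
  "core_ok E i C k \<longleftrightarrow> (\<forall>\<rho>\<in>C. author_ok E i \<rho> k)"

definition tip_anchored ::
  "('tx, 'h) execution \<Rightarrow> nat \<Rightarrow> 'h manifest \<Rightarrow> 'h manifest \<Rightarrow> nat \<Rightarrow> bool" where
  "tip_anchored E i C T k \<longleftrightarrow>
     (\<forall>\<rho>\<in>T. \<forall>\<kappa>\<in>C. rauthor \<kappa> = rauthor \<rho> \<longrightarrow>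
        holds E i \<rho> k \<and> rheight \<kappa> < rheight \<rho> \<and> ancestor E i \<kappa> \<rho> k)"

definition tip_ok ::
  "('tx, 'h) execution \<Rightarrow> nat \<Rightarrow> 'h manifest \<Rightarrow> 'h manifest \<Rightarrow> nat \<Rightarrow> bool" where
  "tip_ok E i C T k \<longleftrightarrow> (\<forall>\<rho>\<in>T. author_ok E i \<rho> k) \<and> tip_anchored E i C T k"

definition core_manifest :: "('tx, 'h) execution \<Rightarrow> nat \<Rightarrow> nat \<Rightarrow> 'h manifest" where
  "core_manifest E i k =
     {\<rho>. rauthor \<rho> \<in> parties E \<and> direct_pub E i \<rho> k \<and> exact_available E (quorum E) i \<rho> k \<and>
         (\<forall>\<sigma>. rauthor \<sigma> = rauthor \<rho> \<and> direct_pub E i \<sigma> k \<and> exact_available E (quorum E) i \<sigma> k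
               \<longrightarrow> rheight \<sigma> \<le> rheight \<rho>)}"

text \<open>Directly published and strictly above the author's core entry (any height if there is none).
  Directly published references of one author lie on one unforked lane, so heights suffice.\<close>

definition tip_candidate :: "('tx, 'h) execution \<Rightarrow> nat \<Rightarrow> 'h ref \<Rightarrow> nat \<Rightarrow> bool" where
  "tip_candidate E i \<rho> k \<longleftrightarrow>
     direct_pub E i \<rho> k \<and>
     (\<forall>\<kappa>\<in>core_manifest E i k. rauthor \<kappa> = rauthor \<rho> \<longrightarrow> rheight \<kappa> < rheight \<rho>)"

definition inexact_candidate :: "('tx, 'h) execution \<Rightarrow> nat \<Rightarrow> 'h ref \<Rightarrow> nat \<Rightarrow> bool" where
  "inexact_candidate E i \<rho> k \<longleftrightarrow>
     tip_candidate E i \<rho> k \<and> available E (quorum E) i \<rho> k \<and>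
     \<not> exact_available E (quorum E) i \<rho> k"

definition tip_manifest :: "('tx, 'h) execution \<Rightarrow> nat \<Rightarrow> nat \<Rightarrow> 'h manifest" where
  "tip_manifest E i k =
     {\<rho>. rauthor \<rho> \<in> parties E \<and> \<not> quarantined E i (rauthor \<rho>) k \<and>
         (if \<exists>\<sigma>. rauthor \<sigma> = rauthor \<rho> \<and> inexact_candidate E i \<sigma> k
          then inexact_candidate E i \<rho> k \<and>
               (\<forall>\<sigma>. rauthor \<sigma> = rauthor \<rho> \<and> inexact_candidate E i \<sigma> k
                     \<longrightarrow> rheight \<rho> \<le> rheight \<sigma>)
          else tip_candidate E i \<rho> k \<and>
               (\<forall>\<sigma>. rauthor \<sigma> = rauthor \<rho> \<and> tip_candidate E i \<sigma> k
                     \<longrightarrow> rheight \<sigma> \<le> rheight \<rho>))}"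

definition wf_manifest :: "('tx, 'h) execution \<Rightarrow> 'h manifest \<Rightarrow> bool" where
  "wf_manifest E C \<longleftrightarrow>
     (\<forall>\<rho>\<in>C. rauthor \<rho> \<in> parties E \<and> 1 \<le> rheight \<rho>) \<and>
     (\<forall>\<rho>\<in>C. \<forall>\<sigma>\<in>C. rauthor \<rho> = rauthor \<sigma> \<longrightarrow> \<rho> = \<sigma>)"

definition wf_proposal :: "('tx, 'h) execution \<Rightarrow> 'h proposal \<Rightarrow> bool" where
  "wf_proposal E B \<longleftrightarrow> wf_manifest E (fst B) \<and> wf_manifest E (snd B)"


section \<open>Pacemaker state\<close>

definition wish :: "('tx, 'h) execution \<Rightarrow> nat \<Rightarrow> nat \<Rightarrow> nat \<Rightarrow> nat" where
  "wish E i j k = Max ({0} \<union> {w. rcvd E i j (Wish w) k})"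

definition nth_largest_wish :: "('tx, 'h) execution \<Rightarrow> nat \<Rightarrow> nat \<Rightarrow> nat \<Rightarrow> nat" where
  "nth_largest_wish E q i k =
     rev (sort (map (\<lambda>j. wish E i j k) [1..<Suc (nparties E)])) ! (q - 1)"

definition wish_plus :: "('tx, 'h) execution \<Rightarrow> nat \<Rightarrow> nat \<Rightarrow> nat" where
  "wish_plus E = nth_largest_wish E (nfaulty E + 1)"

definition wish_quorum :: "('tx, 'h) execution \<Rightarrow> nat \<Rightarrow> nat \<Rightarrow> nat" where
  "wish_quorum E = nth_largest_wish E (quorum E)"

text \<open>\<open>fixes_at E i v B k\<close>: event \<open>k\<close> is the first direct receipt of a view-\<open>v\<close> proposal at \<open>i\<close>.\<close>

definition fixes_at ::
  "('tx, 'h) execution \<Rightarrow> nat \<Rightarrow> nat \<Rightarrow> 'h proposal \<Rightarrow> nat \<Rightarrow> bool" where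
  "fixes_at E i v B k \<longleftrightarrow>
     receives E i (proposer E v) (Proposal v B) k \<and>
     (\<forall>k'<k. \<forall>B'. \<not> receives E i (proposer E v) (Proposal v B') k')"

definition fixed :: "('tx, 'h) execution \<Rightarrow> nat \<Rightarrow> nat \<Rightarrow> 'h proposal \<Rightarrow> nat \<Rightarrow> bool" where
  "fixed E i v B k \<longleftrightarrow> (\<exists>k'<k. fixes_at E i v B k')"

text \<open>The values the responsive frontier \<open>a\<^sub>i\<close> can be raised to; \<open>a\<^sub>i\<close> itself is their maximum.\<close>

inductive frontier_value :: "('tx, 'h) execution \<Rightarrow> nat \<Rightarrow> nat \<Rightarrow> nat \<Rightarrow> bool" for E i k where
  start: "frontier_value E i k 0"
| enter: "entered E i v k \<Longrightarrow> frontier_value E i k (v - 1)"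
| step: "frontier_value E i k a \<Longrightarrow> fixed E i (Suc a) B k \<Longrightarrow> wf_proposal E B
           \<Longrightarrow> frontier_value E i k (Suc a)"

definition frontier :: "('tx, 'h) execution \<Rightarrow> nat \<Rightarrow> nat \<Rightarrow> nat" where
  "frontier E i k = Max {a. frontier_value E i k a}"

text \<open>Views are entered in order, so a view the frontier has reached without activating it is one that
  has been entered.\<close>

definition active ::
  "('tx, 'h) execution \<Rightarrow> nat \<Rightarrow> nat \<Rightarrow> 'h proposal \<Rightarrow> nat \<Rightarrow> bool" where
  "active E i v B k \<longleftrightarrow>
     fixed E i v B k \<and> wf_proposal E B \<and> (entered E i v k \<or> v \<le> frontier E i k)"


section \<open>Responses and counts\<close>

fun echo_resp :: "nat \<Rightarrow> ('tx, 'h) msg \<Rightarrow> bool" where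
  "echo_resp v (Echo u _ _ _) \<longleftrightarrow> u = v"
| "echo_resp v (Echo_Skip u) \<longleftrightarrow> u = v"
| "echo_resp v _ \<longleftrightarrow> False"

fun ready_resp :: "nat \<Rightarrow> ('tx, 'h) msg \<Rightarrow> bool" where
  "ready_resp v (Ready u _ _) \<longleftrightarrow> u = v"
| "ready_resp v (No_Ready u) \<longleftrightarrow> u = v"
| "ready_resp v _ \<longleftrightarrow> False"

text \<open>View 0 stands for all views \<open>\<le> 0\<close>, whose responses are fixed.\<close>

definition echo_done :: "('tx, 'h) execution \<Rightarrow> nat \<Rightarrow> nat \<Rightarrow> nat \<Rightarrow> bool" where
  "echo_done E i v k \<longleftrightarrow> v = 0 \<or> (\<exists>m. echo_resp v m \<and> sent E i m k)"

definition ready_done :: "('tx, 'h) execution \<Rightarrow> nat \<Rightarrow> nat \<Rightarrow> nat \<Rightarrow> bool" where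
  "ready_done E i v k \<longleftrightarrow> v = 0 \<or> (\<exists>m. ready_resp v m \<and> sent E i m k)"

text \<open>Event \<open>k\<close> is the response of \<open>i\<close> completing the pair (echo stage of \<open>v - 1\<close>, initial ready
  stage of \<open>v - 2\<close>).\<close>

definition completes_pair :: "('tx, 'h) execution \<Rightarrow> nat \<Rightarrow> nat \<Rightarrow> nat \<Rightarrow> bool" where
  "completes_pair E i v k \<longleftrightarrow> 2 \<le> v \<and>
     (\<exists>m. ev E k = Bcast i m \<and>
        (echo_resp (v - 1) m \<and> \<not> echo_done E i (v - 1) k \<and> ready_done E i (v - 2) k \<or>
         ready_resp (v - 2) m \<and> \<not> ready_done E i (v - 2) k \<and> echo_done E i (v - 1) k))"

definition echo_count ::
  "('tx, 'h) execution \<Rightarrow> nat \<Rightarrow> nat \<Rightarrow> grade \<Rightarrow> 'h proposal \<Rightarrow> nat \<Rightarrow> nat" where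
  "echo_count E i v g B k = card {j \<in> parties E. \<exists>cl. rcvd E i j (Echo v g B cl) k}"

definition echo_count_any ::
  "('tx, 'h) execution \<Rightarrow> nat \<Rightarrow> nat \<Rightarrow> 'h proposal \<Rightarrow> nat \<Rightarrow> nat" where
  "echo_count_any E i v B k = card {j \<in> parties E. \<exists>g cl. rcvd E i j (Echo v g B cl) k}"

definition ready_count ::
  "('tx, 'h) execution \<Rightarrow> nat \<Rightarrow> nat \<Rightarrow> grade \<Rightarrow> 'h proposal \<Rightarrow> nat \<Rightarrow> nat" where
  "ready_count E i v g B k = card {j \<in> parties E. rcvd E i j (Ready v g B) k}"

definition ready_count_any ::
  "('tx, 'h) execution \<Rightarrow> nat \<Rightarrow> nat \<Rightarrow> 'h proposal \<Rightarrow> nat \<Rightarrow> nat" where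
  "ready_count_any E i v B k = card {j \<in> parties E. \<exists>g. rcvd E i j (Ready v g B) k}"


section \<open>Rules\<close>

definition enter_enabled :: "('tx, 'h) execution \<Rightarrow> nat \<Rightarrow> nat \<Rightarrow> nat \<Rightarrow> bool" where
  "enter_enabled E i v k \<longleftrightarrow> 1 \<le> v \<and> v \<le> wish_quorum E i k \<and> \<not> entered E i v k"

definition wish_enabled :: "('tx, 'h) execution \<Rightarrow> nat \<Rightarrow> nat \<Rightarrow> bool" where
  "wish_enabled E i k \<longleftrightarrow> wish E i i k < wish_plus E i k"

definition propose_enabled :: "('tx, 'h) execution \<Rightarrow> nat \<Rightarrow> nat \<Rightarrow> nat \<Rightarrow> bool" where
  "propose_enabled E i v k \<longleftrightarrow>
     1 \<le> v \<and> i = proposer E v \<and> (v - 1 \<le> frontier E i k \<or> v \<le> wish_plus E i k) \<and>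
     \<not> (\<exists>B. sent E i (Proposal v B) k)"

definition full_echo_enabled ::
  "('tx, 'h) execution \<Rightarrow> nat \<Rightarrow> nat \<Rightarrow> 'h proposal \<Rightarrow> nat \<Rightarrow> bool" where
  "full_echo_enabled E i v B k \<longleftrightarrow>
     \<not> echo_done E i v k \<and> active E i v B k \<and>
     core_ok E i (fst B) k \<and> tip_ok E i (fst B) (snd B) k"

definition ready_enabled ::
  "('tx, 'h) execution \<Rightarrow> nat \<Rightarrow> nat \<Rightarrow> 'h proposal \<Rightarrow> nat \<Rightarrow> bool" where
  "ready_enabled E i v B k \<longleftrightarrow>
     \<not> ready_done E i v k \<and> quorum E \<le> echo_count_any E i v B k"

text \<open>No positive (message-driven) rule of \<open>i\<close> is left to take.\<close>

definition settled :: "('tx, 'h) execution \<Rightarrow> nat \<Rightarrow> nat \<Rightarrow> bool" where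
  "settled E i k \<longleftrightarrow>
     \<not> wish_enabled E i k \<and>
     (\<forall>v. \<not> enter_enabled E i v k \<and> \<not> propose_enabled E i v k \<and>
          (\<forall>B. \<not> full_echo_enabled E i v B k \<and> \<not> ready_enabled E i v B k))"

text \<open>Event \<open>k\<close> happens when the local clock of \<open>i\<close> shows \<open>d\<close>, all messages delivered to \<open>i\<close> by then
  have been processed, and the positive rules they enable have been taken.\<close>

definition at_deadline :: "('tx, 'h) execution \<Rightarrow> nat \<Rightarrow> real \<Rightarrow> nat \<Rightarrow> bool" where
  "at_deadline E i d k \<longleftrightarrow>
     clock E i (tm E k) = d \<and>
     (\<forall>k'\<ge>k. \<forall>j m. ev E k' = Deliver i j m \<longrightarrow> tm E k < tm E k') \<and> settled E i k"

text \<open>Local readings of the deadlines, given the event indices \<open>ke\<close> of entry and \<open>kr\<close> of direct receipt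
  of the proposal; \<open>\<theta>\<^sub>E = 3 \<Delta>\<close> and \<open>\<theta>\<^sub>R = 4 \<Delta>\<close>.\<close>

definition soft_echo_limit :: "('tx, 'h) execution \<Rightarrow> nat \<Rightarrow> nat \<Rightarrow> nat \<Rightarrow> real" where
  "soft_echo_limit E i ke kr =
     min (max (clock E i (tm E ke)) (clock E i (tm E kr)) + Delta E)
         (clock E i (tm E ke) + 3 * Delta E)"

definition echo_limit :: "('tx, 'h) execution \<Rightarrow> nat \<Rightarrow> nat \<Rightarrow> real" where
  "echo_limit E i ke = clock E i (tm E ke) + 3 * Delta E"

definition ready_limit :: "('tx, 'h) execution \<Rightarrow> nat \<Rightarrow> nat \<Rightarrow> real" where
  "ready_limit E i ke = clock E i (tm E ke) + 4 * Delta E"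

definition soft_timeout ::
  "('tx, 'h) execution \<Rightarrow> nat \<Rightarrow> nat \<Rightarrow> 'h proposal \<Rightarrow> nat \<Rightarrow> bool" where
  "soft_timeout E i v B k \<longleftrightarrow>
     active E i v B k \<and>
     (\<exists>ke<k. \<exists>kr<k. ev E ke = Enter i v \<and> fixes_at E i v B kr \<and>
        at_deadline E i (soft_echo_limit E i ke kr) k)"

definition hard_timeout :: "('tx, 'h) execution \<Rightarrow> nat \<Rightarrow> nat \<Rightarrow> nat \<Rightarrow> bool" where
  "hard_timeout E i v k \<longleftrightarrow>
     (\<forall>B. \<not> active E i v B k) \<and>
     (\<exists>ke<k. ev E ke = Enter i v \<and> at_deadline E i (echo_limit E i ke) k)"

definition refine_allowed ::
  "('tx, 'h) execution \<Rightarrow> nat \<Rightarrow> nat \<Rightarrow> grade \<Rightarrow> 'h proposal \<Rightarrow> nat \<Rightarrow> bool" where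
  "refine_allowed E i v g B k \<longleftrightarrow>
     g \<noteq> GMix \<and> sent E i (Ready v GMix B) k \<and>
     (\<forall>g' B'. g' \<noteq> GMix \<longrightarrow> \<not> sent E i (Ready v g' B') k) \<and>
     quorum E \<le> echo_count E i v g B k \<and>
     \<not> (\<forall>j\<in>parties E. \<exists>m. echo_resp v m \<and> rcvd E i j m k) \<and>
     (\<forall>ke<k. ev E ke = Enter i v \<longrightarrow> clock E i (tm E k) < ready_limit E i ke)"

text \<open>\<open>may_send E i m k\<close>: the protocol permits \<open>i\<close> to broadcast \<open>m\<close> as event \<open>k\<close>.  The last disjunct for
  \<open>Wish\<close> is the raise made just before a response that completes a pair.\<close>

fun may_send :: "('tx, 'h) execution \<Rightarrow> nat \<Rightarrow> ('tx, 'h) msg \<Rightarrow> nat \<Rightarrow> bool" where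
  "may_send E i (Publish b) k \<longleftrightarrow>
     author b = i \<and>
     (\<exists>bs. set bs = {b'. sent E i (Publish b') k} \<and> lane_prefix E (block_ref E b) (bs @ [b]))"
| "may_send E i (Proposal v B) k \<longleftrightarrow>
     propose_enabled E i v k \<and> B = (core_manifest E i k, tip_manifest E i k)"
| "may_send E i (Echo v g B cl) k \<longleftrightarrow>
     \<not> echo_done E i v k \<and> cl = claims E i B k \<and>
     (g = G1 \<and> full_echo_enabled E i v B k \<or>
      g = G0 \<and> soft_timeout E i v B k \<and> core_ok E i (fst B) k)"
| "may_send E i (Echo_Skip v) k \<longleftrightarrow>
     \<not> echo_done E i v k \<and>
     ((\<exists>B. soft_timeout E i v B k \<and> \<not> core_ok E i (fst B) k) \<or> hard_timeout E i v k)"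
| "may_send E i (Ready v g B) k \<longleftrightarrow>
     ready_enabled E i v B k \<and>
       g = (if quorum E \<le> echo_count E i v G1 B k then G1
            else if quorum E \<le> echo_count E i v G0 B k then G0 else GMix)
     \<or> refine_allowed E i v g B k"
| "may_send E i (No_Ready v) k \<longleftrightarrow>
     \<not> ready_done E i v k \<and>
     (\<exists>ke<k. ev E ke = Enter i v \<and> at_deadline E i (ready_limit E i ke) k)"
| "may_send E i (Wish w) k \<longleftrightarrow>
     wish E i i k < w \<and>
     (w = 2 \<and> wish E i i k = 0 \<or> w = wish_plus E i k \<or>
      (\<exists>v k'. w = v + 1 \<and> k < k' \<and> tm E k' = tm E k \<and> completes_pair E i v k'))"

text \<open>\<open>promptly E k P\<close>: an event satisfying \<open>P\<close> follows position \<open>k\<close> before time advances.\<close>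

definition promptly :: "('tx, 'h) execution \<Rightarrow> nat \<Rightarrow> (('tx, 'h) event \<Rightarrow> bool) \<Rightarrow> bool" where
  "promptly E k P \<longleftrightarrow> (\<exists>k'\<ge>k. tm E k' = tm E (k - 1) \<and> P (ev E k'))"

text \<open>A proposal completes at \<open>i\<close> at the first position where \<open>i\<close> has counted \<open>Q\<close> READYs for it.\<close>

definition completes ::
  "('tx, 'h) execution \<Rightarrow> nat \<Rightarrow> nat \<Rightarrow> 'h proposal \<Rightarrow> nat \<Rightarrow> bool" where
  "completes E i v B k \<longleftrightarrow>
     quorum E \<le> ready_count_any E i v B k \<and> (\<forall>k'<k. ready_count_any E i v B k' < quorum E)"


section \<open>Executions\<close>

definition timing :: "('tx, 'h) execution \<Rightarrow> bool" where
  "timing E \<longleftrightarrow>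
     3 * nfaulty E + 1 \<le> nparties E \<and> 0 < delta E \<and> delta E \<le> Delta E \<and>
     mono (tm E) \<and> (\<forall>\<tau>. finite {k. tm E k \<le> \<tau>}) \<and>
     (\<forall>i\<in>parties E. strict_mono (clock E i) \<and> continuous_on UNIV (clock E i) \<and>
        (\<forall>x y. gst E \<le> x \<and> x \<le> y \<longrightarrow> clock E i y - clock E i x = y - x))"

definition network :: "('tx, 'h) execution \<Rightarrow> bool" where
  "network E \<longleftrightarrow>
     (\<forall>k i j m. ev E k = Deliver i j m \<longrightarrow>
        i \<in> parties E \<and> j \<in> parties E \<and> i \<noteq> j \<and> sent E j m k) \<and>
     (\<forall>k j m. ev E k = Bcast j m \<longrightarrow>
        (\<forall>i\<in>parties E - {j}. \<exists>k'>k. ev E k' = Deliver i j m \<and>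
           tm E k' \<le> max (tm E k) (gst E) + delta E))"

definition permitted :: "('tx, 'h) execution \<Rightarrow> bool" where
  "permitted E \<longleftrightarrow>
     (\<forall>k i m. ev E k = Bcast i m \<longrightarrow> i \<in> parties E \<and> may_send E i m k) \<and>
     (\<forall>k i v. ev E k = Enter i v \<longrightarrow>
        i \<in> parties E \<and> \<not> entered E i v k \<and>
        (v = 1 \<or> enter_enabled E i v k \<and> entered E i (v - 1) k)) \<and>
     (\<forall>k i v. completes_pair E i v k \<longrightarrow> v + 1 \<le> wish E i i k) \<and>
     (\<forall>i a k. quarantined E i a k \<longrightarrow>
        (\<exists>k0\<le>k. \<exists>v C T. completes E i v (C, T) k0 \<and>
           ready_count E i v G1 (C, T) k0 < quorum E \<and>
           ready_count E i v G0 (C, T) k0 < quorum E \<and>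
           (\<exists>\<rho>\<in>T. rauthor \<rho> = a \<and> \<not> exact_available E (quorum E) i \<rho> k0)))"

definition progress :: "('tx, 'h) execution \<Rightarrow> bool" where
  "progress E \<longleftrightarrow> (\<forall>i\<in>parties E.
     (\<exists>k. tm E k = tm E 0 \<and> ev E k = Enter i 1) \<and>
     (\<exists>k. tm E k = tm E 0 \<and> ev E k = Bcast i (Wish 2)) \<and>
     (\<forall>k. wish_enabled E i k \<longrightarrow>
        promptly E k (\<lambda>e. \<exists>w\<ge>wish_plus E i k. e = Bcast i (Wish w))) \<and>
     (\<forall>k v. enter_enabled E i v k \<longrightarrow> promptly E k (\<lambda>e. e = Enter i v)) \<and>
     (\<forall>k v. propose_enabled E i v k \<longrightarrow>
        promptly E k (\<lambda>e. \<exists>B. e = Bcast i (Proposal v B))) \<and>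
     (\<forall>k v B. full_echo_enabled E i v B k \<longrightarrow>
        promptly E k (\<lambda>e. \<exists>cl. e = Bcast i (Echo v G1 B cl))) \<and>
     (\<forall>k v B. ready_enabled E i v B k \<longrightarrow>
        promptly E k (\<lambda>e. \<exists>g. e = Bcast i (Ready v g B))) \<and>
     (\<forall>v ke. ev E ke = Enter i v \<longrightarrow>
        (\<exists>k m. ev E k = Bcast i m \<and> echo_resp v m \<and>
           clock E i (tm E k) \<le> echo_limit E i ke) \<and>
        (\<forall>B kr. fixes_at E i v B kr \<and> wf_proposal E B \<longrightarrow>
           (\<exists>k m. ev E k = Bcast i m \<and> echo_resp v m \<and>
              clock E i (tm E k) \<le> soft_echo_limit E i ke kr)) \<and>
        (\<exists>k m. ev E k = Bcast i m \<and> ready_resp v m \<and>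
           clock E i (tm E k) \<le> ready_limit E i ke)))"

definition vantage :: "('tx, 'h) execution \<Rightarrow> bool" where
  "vantage E \<longleftrightarrow> timing E \<and> network E \<and> permitted E \<and> progress E"

text \<open>\<open>places E a tx b t\<close>: \<open>tx\<close> arrives at \<open>a\<close> at time \<open>t\<close> and \<open>a\<close> at once publishes it in its new
  block \<open>b\<close>.\<close>

definition places ::
  "('tx, 'h) execution \<Rightarrow> nat \<Rightarrow> 'tx \<Rightarrow> ('tx, 'h) block \<Rightarrow> real \<Rightarrow> bool" where
  "places E a tx b t \<longleftrightarrow>
     (\<exists>k k'. k < k' \<and> tm E k = t \<and> tm E k' = t \<and> ev E k = Arrive a tx \<and>
             ev E k' = Bcast a (Publish b) \<and> tx \<in> set (txs b))"

definition publishes_at_once :: "('tx, 'h) execution \<Rightarrow> bool" where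
  "publishes_at_once E \<longleftrightarrow>
     (\<forall>k a tx. ev E k = Arrive a tx \<longrightarrow> a \<in> parties E \<and>
        (\<exists>k'>k. tm E k' = tm E k \<and>
           (\<exists>b. ev E k' = Bcast a (Publish b) \<and> tx \<in> set (txs b))))"


section \<open>Seals and sequencing\<close>

datatype seal_rule = Fast_Seal | Ready_Path

datatype 'h seal = Commit_Full "'h manifest" "'h manifest" | Commit_Core "'h manifest"

fun core_refs :: "'h seal \<Rightarrow> 'h manifest" where
  "core_refs (Commit_Full C T) = C"
| "core_refs (Commit_Core C) = C"

fun named_refs :: "'h seal \<Rightarrow> 'h manifest" where
  "named_refs (Commit_Full C T) = C \<union> T"
| "named_refs (Commit_Core C) = C"

definition seal_condition ::
  "('tx, 'h) execution \<Rightarrow> seal_rule set \<Rightarrow> nat \<Rightarrow> nat \<Rightarrow> 'h seal \<Rightarrow> nat \<Rightarrow> bool" where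
  "seal_condition E R i v d k \<longleftrightarrow>
     (\<exists>C T. d = Commit_Full C T \<and>
        (Fast_Seal \<in> R \<and> (\<forall>j\<in>parties E. \<exists>cl. rcvd E i j (Echo v G1 (C, T) cl) k) \<or>
         Ready_Path \<in> R \<and> quorum E \<le> ready_count E i v G1 (C, T) k)) \<or>
     (\<exists>C T. d = Commit_Core C \<and> Ready_Path \<in> R \<and> quorum E \<le> ready_count E i v G0 (C, T) k)"

text \<open>The first seal is kept.  \<open>R\<close> is the set of sealing rules taken into account.\<close>

definition sealed ::
  "('tx, 'h) execution \<Rightarrow> seal_rule set \<Rightarrow> nat \<Rightarrow> nat \<Rightarrow> 'h seal \<Rightarrow> nat \<Rightarrow> bool" where
  "sealed E R i v d k \<longleftrightarrow>
     (\<exists>k0\<le>k. seal_condition E R i v d k0 \<and> (\<forall>k'<k0. \<forall>d'. \<not> seal_condition E R i v d' k'))"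

text \<open>\<open>processed E r R i v k\<close>: views \<open>1..v\<close> have been sealed and output at \<open>i\<close>, counting only seals by
  rules in \<open>R\<close> for views from \<open>r\<close> on.  The protocol itself is the case \<open>R = UNIV\<close> (\<open>r\<close> is then
  irrelevant); smaller \<open>R\<close> tell how fast one sealing path alone sequences.  Output requires holding the
  blocks to be appended.\<close>

definition rules_from :: "nat \<Rightarrow> seal_rule set \<Rightarrow> nat \<Rightarrow> seal_rule set" where
  "rules_from r R v = (if v < r then UNIV else R)"

definition processed ::
  "('tx, 'h) execution \<Rightarrow> nat \<Rightarrow> seal_rule set \<Rightarrow> nat \<Rightarrow> nat \<Rightarrow> nat \<Rightarrow> bool" where
  "processed E r R i v k \<longleftrightarrow>
     (\<forall>u\<in>{1..v}. \<exists>d. sealed E (rules_from r R u) i u d k \<and>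
        (\<forall>\<rho>\<in>named_refs d. holds E i \<rho> k))"

text \<open>\<open>cov\<close> is \<open>named_refs\<close> for actual sequencing and \<open>core_refs\<close> when tips are ignored.\<close>

definition sequenced_at ::
  "('tx, 'h) execution \<Rightarrow> nat \<Rightarrow> seal_rule set \<Rightarrow> ('h seal \<Rightarrow> 'h manifest) \<Rightarrow> nat \<Rightarrow>
   ('tx, 'h) block \<Rightarrow> nat \<Rightarrow> bool" where
  "sequenced_at E r R cov i b k \<longleftrightarrow>
     (\<exists>v\<ge>1. processed E r R i v k \<and>
        (\<exists>d. sealed E (rules_from r R v) i v d k \<and> (\<exists>\<rho>\<in>cov d. covers E \<rho> b)))"

definition by_time :: "('tx, 'h) execution \<Rightarrow> real \<Rightarrow> (nat \<Rightarrow> bool) \<Rightarrow> bool" where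
  "by_time E \<tau> P \<longleftrightarrow> (\<exists>k. (\<forall>k'<k. tm E k' \<le> \<tau>) \<and> P k)"

definition sequenced_by ::
  "('tx, 'h) execution \<Rightarrow> nat \<Rightarrow> seal_rule set \<Rightarrow> ('h seal \<Rightarrow> 'h manifest) \<Rightarrow>
   ('tx, 'h) block \<Rightarrow> real \<Rightarrow> bool" where
  "sequenced_by E r R cov b \<tau> \<longleftrightarrow>
     (\<forall>i\<in>parties E. by_time E \<tau> (sequenced_at E r R cov i b))"

definition L_tip :: "('tx, 'h) execution \<Rightarrow> nat \<Rightarrow> ('tx, 'h) block \<Rightarrow> real \<Rightarrow> real" where
  "L_tip E r b t = Inf {\<tau>. sequenced_by E r UNIV named_refs b \<tau>} - t"

definition L_core :: "('tx, 'h) execution \<Rightarrow> nat \<Rightarrow> ('tx, 'h) block \<Rightarrow> real \<Rightarrow> real" where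
  "L_core E r b t = Inf {\<tau>. sequenced_by E r UNIV core_refs b \<tau>} - t"


section \<open>Responsive suffixes and proposal opportunities\<close>

definition proposes :: "('tx, 'h) execution \<Rightarrow> nat \<Rightarrow> 'h proposal \<Rightarrow> nat \<Rightarrow> bool" where
  "proposes E v B k \<longleftrightarrow> ev E k = Bcast (proposer E v) (Proposal v B)"

definition proposed_by :: "('tx, 'h) execution \<Rightarrow> nat \<Rightarrow> real \<Rightarrow> bool" where
  "proposed_by E v \<tau> \<longleftrightarrow> (\<exists>B k. proposes E v B k \<and> tm E k \<le> \<tau>)"

definition beta :: "('tx, 'h) execution \<Rightarrow> nat \<Rightarrow> real" where
  "beta E v = tm E (LEAST k. \<exists>B. proposes E v B k)"

definition pacemaker_cutoff :: "('tx, 'h) execution \<Rightarrow> nat \<Rightarrow> bool" where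
  "pacemaker_cutoff E V \<longleftrightarrow>
     (\<forall>k i v. tm E k < gst E \<longrightarrow>
        (ev E k = Enter i v \<longrightarrow> v < V) \<and>
        (\<forall>B. ev E k = Bcast i (Proposal v B) \<longrightarrow> v < V) \<and>
        (\<forall>m. ev E k = Bcast i m \<and> (echo_resp v m \<or> ready_resp v m) \<longrightarrow> v < V) \<and>
        (ev E k = Bcast i (Wish v) \<longrightarrow> v < V)) \<and>
     (\<forall>v\<ge>V. \<forall>i\<in>parties E. \<exists>k. ev E k = Enter i v \<and>
        (\<forall>j k'. ev E k' = Enter j v \<longrightarrow> tm E k \<le> tm E k' + delta E))"

definition responsive_suffix :: "('tx, 'h) execution \<Rightarrow> nat \<Rightarrow> bool" where
  "responsive_suffix E r \<longleftrightarrow>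
     vantage E \<and> publishes_at_once E \<and> 1 \<le> r \<and> (\<exists>V\<le>r. pacemaker_cutoff E V) \<and>
     (\<exists>B k. proposes E r B k) \<and>
     (\<forall>v\<in>{1..<r}. proposed_by E v (beta E r) \<and>
        (\<forall>i\<in>parties E. by_time E (beta E r) (processed E r UNIV i v)))"

definition prefix_extending :: "('tx, 'h) execution \<Rightarrow> nat \<Rightarrow> bool" where
  "prefix_extending E v \<longleftrightarrow>
     1 \<le> v \<and> (\<exists>B k. proposes E v B k) \<and> (\<forall>u\<in>{1..<v}. proposed_by E u (beta E v))"

definition opportunities :: "('tx, 'h) execution \<Rightarrow> nat \<Rightarrow> real set" where
  "opportunities E r = {beta E v | v. r \<le> v \<and> prefix_extending E v}"

definition next_opportunity :: "('tx, 'h) execution \<Rightarrow> nat \<Rightarrow> real \<Rightarrow> real" where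
  "next_opportunity E r \<tau> = Inf {s \<in> opportunities E r. \<tau> < s}"

text \<open>The chronological opportunity times of the suffix, numbered from 0.\<close>

primrec opportunity :: "('tx, 'h) execution \<Rightarrow> nat \<Rightarrow> nat \<Rightarrow> real" where
  "opportunity E r 0 = Inf (opportunities E r)"
| "opportunity E r (Suc j) = next_opportunity E r (opportunity E r j)"

definition opportunity_intervals ::
  "('tx, 'h) execution \<Rightarrow> nat \<Rightarrow> nat set \<Rightarrow> real set" where
  "opportunity_intervals E r J = (\<Union>j\<in>J. {opportunity E r j ..< opportunity E r (Suc j)})"

text \<open>The time from which all parties have received \<open>b\<close>, with its lane prefix, directly.\<close>

definition eligibility :: "('tx, 'h) execution \<Rightarrow> ('tx, 'h) block \<Rightarrow> real" where
  "eligibility E b =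
     Inf {\<tau>. \<forall>i\<in>parties E. by_time E \<tau> (direct_pub E i (block_ref E b))}"

definition anchoring ::
  "('tx, 'h) execution \<Rightarrow> 'h proposal \<Rightarrow> ('tx, 'h) block \<Rightarrow> bool" where
  "anchoring E B b \<longleftrightarrow> (\<exists>\<rho>\<in>snd B. covers E \<rho> b)"

text \<open>The tip rule lets the proposal sent by \<open>i\<close> at position \<open>k\<close> cover \<open>b\<close>, unless its core already
  does: the author is not quarantined there, and the preference for the least available but not exactly
  available reference does not select one below \<open>b\<close>.  Both obstructions can occur with all parties
  correct, since quarantines may predate the suffix and since ECHOs may be counted in any order.\<close>

definition coverable :: "('tx, 'h) execution \<Rightarrow> nat \<Rightarrow> ('tx, 'h) block \<Rightarrow> nat \<Rightarrow> bool" where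
  "coverable E i b k \<longleftrightarrow>
     (\<exists>\<kappa>\<in>core_manifest E i k. covers E \<kappa> b) \<or>
     (\<not> quarantined E i (author b) k \<and>
      (\<forall>\<sigma>. rauthor \<sigma> = author b \<and> inexact_candidate E i \<sigma> k \<longrightarrow> height b \<le> rheight \<sigma>))"

definition tip_eligible :: "('tx, 'h) execution \<Rightarrow> nat \<Rightarrow> ('tx, 'h) block \<Rightarrow> bool" where
  "tip_eligible E r b \<longleftrightarrow>
     (\<forall>v B k. r \<le> v \<and> prefix_extending E v \<and> proposes E v B k \<and>
        tm E k = next_opportunity E r (eligibility E b) \<longrightarrow> coverable E (proposer E v) b k)"

text \<open>On the core path the anchoring reference must in addition collect exact acknowledgments.  This
  can fail only if it is newer than \<open>b\<close> and its author has no core entry in the same proposal: tip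
  anchoring is then void, and a party may ECHO on \<open>f + 1\<close> acknowledgments without having received the
  newer block.\<close>

definition ack_eligible :: "('tx, 'h) execution \<Rightarrow> nat \<Rightarrow> ('tx, 'h) block \<Rightarrow> bool" where
  "ack_eligible E r b \<longleftrightarrow>
     (\<forall>v C T k \<rho>. r \<le> v \<and> prefix_extending E v \<and> proposes E v (C, T) k \<and>
        tm E k = next_opportunity E r (eligibility E b) \<and>
        \<rho> \<in> T \<and> covers E \<rho> b \<and> height b < rheight \<rho> \<and> (\<forall>\<kappa>\<in>C. rauthor \<kappa> \<noteq> author b) \<longrightarrow>
        quorum E \<le> card {j \<in> parties E. \<exists>k' g cl.
          ev E k' = Bcast j (Echo v g (C, T) cl) \<and> (\<rho>, Exact) \<in> cl})"

text \<open>\<open>i\<close> has counted the acknowledgment quorum of the view-\<open>u\<close> proposal \<open>B\<close> for \<open>\<rho>\<close>, which makes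
  \<open>\<rho>\<close> exact-\<open>Q\<close>-available.\<close>

definition ack_quorum ::
  "('tx, 'h) execution \<Rightarrow> nat \<Rightarrow> nat \<Rightarrow> 'h proposal \<Rightarrow> 'h ref \<Rightarrow> nat \<Rightarrow> bool" where
  "ack_quorum E i u B \<rho> k \<longleftrightarrow>
     quorum E \<le> card {j \<in> parties E. \<exists>g cl. rcvd E i j (Echo u g B cl) k \<and> (\<rho>, Exact) \<in> cl}"

end

(* Past the cutoff every party receives the view-v proposal, and every lane it names, before any ECHO
   deadline of view v, so all ECHOs and READYs are of grade 1 and the view can only be sealed in full.
   A prefix-extending proposal sent at s reaches everyone by s + delta and brings every responsive
   frontier to its view; hence its view and all earlier ones are ECHOed by s + delta, fast-sealed by
   s + 2 delta and READY-sealed by s + 3 delta.  Applied to the least view not proposed by time s, the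
   frontier argument also gives an opportunity in (s, s + delta].  Thus the wait from s for the next
   opportunity is at most delta, and for uniform s on opportunity intervals of lengths l_j <= delta its
   mean is (sum l_j^2 / 2) / (sum l_j) <= delta / 2. *)

theory Submission
  imports Defs
begin

section \<open>Vantage executions\<close>

text \<open>Real time and event order are kept apart. Upper bounds are read off at positions
  \<open>cut \<tau>\<close>, where no positive rule is enabled. A timeout has to be refuted at its
  own position, because for \<open>delta E = Delta E\<close> the soft ECHO deadline may coincide
  with the last possible receipt. Blocks travel only from their authors, so holding a lane is the
  same as direct publication. The lanes that a proposal names were broadcast before it, hence they
  reach everyone within the delay bound of the proposal itself. Publication and the first wait cost
  one delay each. From the anchoring proposal on, the tip path needs two delays; the core path needs
  five: two for the ECHO acknowledgments, one for a second wait, two for sealing. Only the first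
  wait is averaged and the second keeps its worst case, so both means are lower by delta/2. The
  eligibility time of a given block in a given execution is a number. The averaged latencies
  therefore range over executions that have the opportunity times in common.\<close>

locale vantage_execution =
  fixes E :: "('tx, 'h) execution"
  assumes vantage: "vantage E"
begin

lemma timing: "timing E" and network: "network E" and permitted: "permitted E"
  and progress: "progress E"
  using vantage by (auto simp: vantage_def)

lemma delta_pos: "0 < delta E" and delta_le: "delta E \<le> Delta E"
  and resilience: "3 * nfaulty E + 1 \<le> nparties E"
  using timing by (auto simp: timing_def)

lemma tm_mono: "k \<le> k' \<Longrightarrow> tm E k \<le> tm E k'"
  using timing by (auto simp: timing_def mono_def)

lemma less_if_tm_less: "tm E k < tm E k' \<Longrightarrow> k < k'"
  using tm_mono[of k' k] by (meson leD not_le)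

lemma finite_tm_le: "finite {k. tm E k \<le> \<tau>}"
  using timing by (auto simp: timing_def)

lemma clock_diff:
  "i \<in> parties E \<Longrightarrow> gst E \<le> x \<Longrightarrow> x \<le> y \<Longrightarrow> clock E i y = clock E i x + (y - x)"
  using timing by (fastforce simp: timing_def)

lemma finite_parties: "finite (parties E)"
  by (simp add: parties_def)

lemma card_parties: "card (parties E) = nparties E"
  by (simp add: parties_def)

lemma quorum_pos: "0 < quorum E" and quorum_le: "quorum E \<le> nparties E"
  using resilience by (auto simp: quorum_def)

lemma proposer_in_parties: "proposer E v \<in> parties E"
proof -
  have "(v - 1) mod nparties E < nparties E"
    using resilience by simp
  thus ?thesis
    by (simp add: proposer_def parties_def)
qed

lemma parties_nonempty: "parties E \<noteq> {}"
  using proposer_in_parties by blast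

lemma quorum_witness: "quorum E \<le> card {j \<in> parties E. P j} \<Longrightarrow> \<exists>j\<in>parties E. P j"
  using quorum_pos by (metis (mono_tags, lifting) Collect_empty_eq card.empty leD)

lemma quorum_of_all: "(\<And>j. j \<in> parties E \<Longrightarrow> P j) \<Longrightarrow> quorum E \<le> card {j \<in> parties E. P j}"
proof -
  assume "\<And>j. j \<in> parties E \<Longrightarrow> P j"
  hence "{j \<in> parties E. P j} = parties E"
    by auto
  thus ?thesis
    using quorum_le card_parties by simp
qed

text \<open>The position after all events of time at most \<open>\<tau>\<close>.  Since progress is prompt, no rule is enabled
  there.\<close>

definition cut :: "real \<Rightarrow> nat" where
  "cut \<tau> = (LEAST k. \<tau> < tm E k)"

text \<open>Non-Zenoness yields an event after \<open>\<tau>\<close>, so the \<open>LEAST\<close> is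
  attained; monotonicity of \<open>tm\<close> makes the events of time at most \<open>\<tau>\<close>
  an initial segment.\<close>

lemma less_cut_iff: "k < cut \<tau> \<longleftrightarrow> tm E k \<le> \<tau>"
proof -
  have "{k. tm E k \<le> \<tau>} \<noteq> UNIV"
    using finite_tm_le[of \<tau>] infinite_UNIV_nat by metis
  then obtain k0 where "\<tau> < tm E k0"
    using not_le by blast
  hence late: "\<tau> < tm E (cut \<tau>)"
    unfolding cut_def by (rule LeastI)
  show ?thesis
  proof
    assume "k < cut \<tau>"
    thus "tm E k \<le> \<tau>"
      unfolding cut_def using not_less_Least not_less by blast
  next
    assume "tm E k \<le> \<tau>"
    thus "k < cut \<tau>"
      using late less_if_tm_less by (meson le_less_trans)
  qed
qed

lemma cut_mono: "\<tau> \<le> \<tau>' \<Longrightarrow> cut \<tau> \<le> cut \<tau>'"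
  by (meson less_cut_iff not_less order.trans less_le_not_le)

lemma by_time_cut: "P (cut \<tau>) \<Longrightarrow> by_time E \<tau> P"
  unfolding by_time_def using less_cut_iff by blast

text \<open>Among the positions that \<open>by_time\<close> admits, \<open>cut \<tau>\<close> is the
  last one, so a persistent predicate can be tested there.\<close>

lemma by_time_iff:
  assumes "\<And>k k'. k \<le> k' \<Longrightarrow> P k \<Longrightarrow> P k'"
  shows "by_time E \<tau> P \<longleftrightarrow> P (cut \<tau>)"
proof
  assume "by_time E \<tau> P"
  then obtain k where k: "\<forall>k'<k. tm E k' \<le> \<tau>" "P k"
    by (auto simp: by_time_def)
  hence "k \<le> cut \<tau>"
    using less_cut_iff by (meson less_irrefl not_less)
  thus "P (cut \<tau>)"
    using assms k by blast
qed (rule by_time_cut)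

text \<open>A prompt reaction carries the time of event \<open>cut \<tau> - 1\<close>, which is at
  most \<open>\<tau>\<close>, but every position from \<open>cut \<tau>\<close> on is later. An
  empty prefix is excluded because the subtraction would be truncated.\<close>

lemma not_promptly_cut:
  assumes "0 < cut \<tau>"
  shows "\<not> promptly E (cut \<tau>) P"
proof
  assume "promptly E (cut \<tau>) P"
  then obtain k where k: "cut \<tau> \<le> k" "tm E k = tm E (cut \<tau> - 1)"
    by (auto simp: promptly_def)
  have "tm E (cut \<tau> - 1) \<le> \<tau>"
    using assms less_cut_iff[of "cut \<tau> - 1" \<tau>] by simp
  hence "k < cut \<tau>"
    using k by (simp add: less_cut_iff)
  with k show False
    by simp
qed

lemma settled_cut:
  assumes "i \<in> parties E" "0 < cut \<tau>"
  shows "\<not> propose_enabled E i v (cut \<tau>)" "\<not> full_echo_enabled E i v B (cut \<tau>)"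
    "\<not> ready_enabled E i v B (cut \<tau>)"
  using progress[unfolded progress_def, rule_format, OF assms(1)] not_promptly_cut[OF assms(2)]
  by blast+

subsection \<open>Receipt\<close>

lemma rcvd_mono: "k \<le> k' \<Longrightarrow> rcvd E i j m k \<Longrightarrow> rcvd E i j m k'"
  by (auto simp: rcvd_def intro: less_le_trans)

lemma receives_sent: "receives E i j m k \<Longrightarrow> \<exists>k'\<le>k. ev E k' = Bcast j m"
  using network unfolding receives_def network_def sent_def by (metis less_imp_le order_refl)

lemma receives_in_parties: "receives E i j m k \<Longrightarrow> i \<in> parties E \<and> j \<in> parties E"
  using network permitted by (auto simp: receives_def network_def permitted_def)

lemma rcvd_sent: "rcvd E i j m k \<Longrightarrow> sent E j m k"
  unfolding rcvd_def sent_def using receives_sent le_less_trans by blast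

lemma rcvd_by:
  assumes "ev E k = Bcast j m" "tm E k \<le> s" "gst E \<le> s" "i \<in> parties E"
  shows "rcvd E i j m (cut (s + delta E))"
proof (cases "i = j")
  case True
  have "k < cut (s + delta E)"
    using assms delta_pos by (simp add: less_cut_iff)
  thus ?thesis
    using True assms by (auto simp: rcvd_def receives_def)
next
  case False
  then obtain k' where "ev E k' = Deliver i j m" "tm E k' \<le> max (tm E k) (gst E) + delta E"
    using network assms unfolding network_def by blast
  moreover from this have "k' < cut (s + delta E)"
    using assms by (simp add: less_cut_iff)
  ultimately show ?thesis
    by (auto simp: rcvd_def receives_def)
qed

text \<open>At a deadline all messages due by then have been processed; a party's own messages may carry the
  same time, so they are compared by position.\<close>

lemma rcvd_at_deadline:
  assumes "at_deadline E i d k" "ev E k' = Bcast j m" "k' < k" "max (tm E k') (gst E) + delta E \<le> tm E k"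
    and "i \<in> parties E"
  shows "rcvd E i j m k"
proof (cases "i = j")
  case True
  thus ?thesis
    using assms by (auto simp: rcvd_def receives_def)
next
  case False
  then obtain k'' where "ev E k'' = Deliver i j m" "tm E k'' \<le> max (tm E k') (gst E) + delta E"
    using network assms unfolding network_def by blast
  moreover from this have "k'' < k"
    using assms unfolding at_deadline_def by (meson leD not_le order.trans)
  ultimately show ?thesis
    by (auto simp: rcvd_def receives_def)
qed

lemma may_send: "ev E k = Bcast i m \<Longrightarrow> i \<in> parties E \<and> may_send E i m k"
  using permitted by (auto simp: permitted_def)

subsection \<open>Lanes\<close>

definition published_lane :: "'h ref \<Rightarrow> ('tx, 'h) block list \<Rightarrow> bool" where
  "published_lane \<rho> bs \<longleftrightarrow>
     lane_prefix E \<rho> bs \<and> (\<forall>b\<in>set bs. \<exists>k. ev E k = Bcast (rauthor \<rho>) (Publish b))"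

lemma publish_author: "ev E k = Bcast j (Publish b) \<Longrightarrow> author b = j"
  using may_send by fastforce

lemma publish_height_less:
  assumes "ev E k = Bcast j (Publish b)" "ev E k' = Bcast j (Publish b')" "k < k'"
  shows "height b < height b'"
proof -
  obtain bs where bs: "set bs = {b''. sent E j (Publish b'') k'}"
    "lane_prefix E (block_ref E b') (bs @ [b'])"
    using may_send[OF assms(2)] by auto
  have "b \<in> set bs"
    using assms by (auto simp: bs sent_def)
  then obtain l where l: "l < length bs" "b = bs ! l"
    by (auto simp: in_set_conv_nth)
  have "height ((bs @ [b']) ! l) = Suc l"
    using bs(2) l by (auto simp: lane_prefix_def)
  hence "height b = Suc l"
    using l by (simp add: nth_append)
  moreover have "height b' = Suc (length bs)"
    using bs(2) by (auto simp: lane_prefix_def block_ref_def)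
  ultimately show ?thesis
    using l by simp
qed

lemma publish_unique:
  assumes "ev E k = Bcast j (Publish b)" "ev E k' = Bcast j (Publish b')" "height b = height b'"
  shows "k = k'" "b = b'"
proof -
  show "k = k'"
    using publish_height_less[OF assms(1,2)] publish_height_less[OF assms(2,1)] assms(3)
    by (metis less_irrefl nat_neq_iff)
  thus "b = b'"
    using assms by simp
qed

lemma published_lane_unique:
  assumes "published_lane \<rho> bs" "published_lane \<sigma> cs" "rauthor \<rho> = rauthor \<sigma>"
    "rheight \<rho> \<le> rheight \<sigma>"
  shows "bs = take (rheight \<rho>) cs"
proof (rule nth_equalityI)
  show "length bs = length (take (rheight \<rho>) cs)"
    using assms by (auto simp: published_lane_def lane_prefix_def)
  fix l assume l: "l < length bs"
  hence l': "l < length cs" "l < rheight \<rho>"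
    using assms by (auto simp: published_lane_def lane_prefix_def)
  have "height (bs ! l) = height (cs ! l)"
    using assms l l' by (auto simp: published_lane_def lane_prefix_def)
  moreover obtain k k' where "ev E k = Bcast (rauthor \<rho>) (Publish (bs ! l))"
    "ev E k' = Bcast (rauthor \<rho>) (Publish (cs ! l))"
    using assms l l' unfolding published_lane_def by (metis nth_mem)
  ultimately show "bs ! l = take (rheight \<rho>) cs ! l"
    using publish_unique l' by simp
qed

lemma direct_pub_published_lane:
  assumes "lane_prefix E \<rho> bs" "\<forall>b\<in>set bs. rcvd E i (rauthor \<rho>) (Publish b) k"
  shows "published_lane \<rho> bs"
  using assms rcvd_sent unfolding published_lane_def sent_def by blast

lemma direct_pub_eq:
  assumes "direct_pub E i \<rho> k" "direct_pub E j \<sigma> k'" "rauthor \<rho> = rauthor \<sigma>" "rheight \<rho> = rheight \<sigma>"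
  shows "\<rho> = \<sigma>"
proof -
  obtain bs cs where bs: "published_lane \<rho> bs" "published_lane \<sigma> cs"
    using assms direct_pub_published_lane unfolding direct_pub_def by meson
  hence "bs = cs"
    using published_lane_unique[OF bs assms(3)] assms(4)
    by (auto simp: published_lane_def lane_prefix_def)
  thus ?thesis
    using bs assms by (auto simp: published_lane_def lane_prefix_def intro: ref.expand)
qed

lemma direct_pub_mono: "k \<le> k' \<Longrightarrow> direct_pub E i \<rho> k \<Longrightarrow> direct_pub E i \<rho> k'"
  unfolding direct_pub_def using rcvd_mono[of k k'] by blast

lemma holds_mono: "k \<le> k' \<Longrightarrow> holds E i \<rho> k \<Longrightarrow> holds E i \<rho> k'"
  unfolding holds_def holds_prefix_def using rcvd_mono[of k k'] by meson

lemma direct_pub_author: "direct_pub E i \<rho> k \<Longrightarrow> rauthor \<rho> \<in> parties E"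
proof -
  assume "direct_pub E i \<rho> k"
  then obtain bs where "bs \<noteq> []" "\<forall>b\<in>set bs. rcvd E i (rauthor \<rho>) (Publish b) k"
    by (auto simp: direct_pub_def lane_prefix_def)
  hence "rcvd E i (rauthor \<rho>) (Publish (hd bs)) k"
    by simp
  thus ?thesis
    unfolding rcvd_def using receives_in_parties by blast
qed

lemma direct_pub_height: "direct_pub E i \<rho> k \<Longrightarrow> 1 \<le> rheight \<rho>"
proof -
  assume "direct_pub E i \<rho> k"
  then obtain bs where "lane_prefix E \<rho> bs"
    by (auto simp: direct_pub_def)
  hence "bs \<noteq> []" "length bs = rheight \<rho>"
    by (simp_all add: lane_prefix_def)
  thus ?thesis
    by (cases bs) auto
qed

lemma holds_prefix_iff:
  "holds_prefix E i \<rho> bs k \<longleftrightarrow>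
     lane_prefix E \<rho> bs \<and> (\<forall>b\<in>set bs. rcvd E i (rauthor \<rho>) (Publish b) k)" (is "?l \<longleftrightarrow> ?r")
proof
  assume l: ?l
  have "rcvd E i (rauthor \<rho>) (Publish b) k" if b: "b \<in> set bs" for b
  proof -
    obtain j where j: "rcvd E i j (Publish b) k"
      using l b by (auto simp: holds_prefix_def)
    hence "author b = j"
      using rcvd_sent publish_author unfolding sent_def by blast
    moreover have "author b = rauthor \<rho>"
      using l b by (auto simp: holds_prefix_def lane_prefix_def in_set_conv_nth)
    ultimately show ?thesis
      using j by simp
  qed
  thus ?r
    using l by (auto simp: holds_prefix_def)
next
  assume r: ?r
  hence "direct_pub E i \<rho> k"
    by (auto simp: direct_pub_def)
  thus ?l
    using r direct_pub_author by (auto simp: holds_prefix_def)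
qed

lemma holds_iff_direct_pub: "holds E i \<rho> k \<longleftrightarrow> direct_pub E i \<rho> k"
  by (auto simp: holds_def direct_pub_def holds_prefix_iff)

lemma direct_pub_spread:
  assumes "direct_pub E j \<rho> k" "\<And>k'. k' < k \<Longrightarrow> tm E k' \<le> s" "gst E \<le> s" "i \<in> parties E"
  shows "direct_pub E i \<rho> (cut (s + delta E))"
proof -
  obtain bs where bs: "lane_prefix E \<rho> bs" "\<forall>b\<in>set bs. rcvd E j (rauthor \<rho>) (Publish b) k"
    using assms by (auto simp: direct_pub_def)
  have "rcvd E i (rauthor \<rho>) (Publish b) (cut (s + delta E))" if "b \<in> set bs" for b
    using that bs rcvd_sent rcvd_by assms(2-4) unfolding sent_def by meson
  thus ?thesis
    using bs by (auto simp: direct_pub_def)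
qed

text \<open>The bound \<open>k0 \<le> k\<close> on positions serves a party's own blocks, for which
  there is no delivery event to compare with the deadline.\<close>

lemma direct_pub_at_deadline:
  assumes "direct_pub E j \<rho> k0" "k0 \<le> k" "\<And>k'. k' < k0 \<Longrightarrow> max (tm E k') (gst E) + delta E \<le> tm E k"
    "at_deadline E i d k" "i \<in> parties E"
  shows "direct_pub E i \<rho> k"
proof -
  obtain bs where bs: "lane_prefix E \<rho> bs" "\<forall>b\<in>set bs. rcvd E j (rauthor \<rho>) (Publish b) k0"
    using assms by (auto simp: direct_pub_def)
  have "rcvd E i (rauthor \<rho>) (Publish b) k" if b: "b \<in> set bs" for b
  proof -
    obtain k' where "k' < k0" "ev E k' = Bcast (rauthor \<rho>) (Publish b)"
      using b bs rcvd_sent unfolding sent_def by blast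
    thus ?thesis
      using rcvd_at_deadline[OF assms(4)] assms(2,3,5) by auto
  qed
  thus ?thesis
    using bs by (auto simp: direct_pub_def)
qed

text \<open>The lane has a block at each height up to \<open>rheight \<rho>\<close>, and an author
  publishes only one block per height. Coverage therefore becomes a comparison of heights.\<close>

lemma covers_direct_pub:
  assumes "direct_pub E i \<rho> k" "ev E k0 = Bcast (rauthor \<rho>) (Publish b)" "height b \<le> rheight \<rho>"
    "1 \<le> height b"
  shows "covers E \<rho> b"
proof -
  obtain bs where bs: "published_lane \<rho> bs"
    using assms direct_pub_published_lane unfolding direct_pub_def by meson
  let ?b = "bs ! (height b - 1)"
  have l: "height b - 1 < length bs"
    using bs assms(3,4) by (auto simp: published_lane_def lane_prefix_def)
  obtain k' where "ev E k' = Bcast (rauthor \<rho>) (Publish ?b)"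
    using bs l unfolding published_lane_def by (meson nth_mem)
  moreover have "height ?b = height b"
    using bs l assms(4) by (auto simp: published_lane_def lane_prefix_def)
  ultimately have "?b = b"
    using publish_unique assms(2) by metis
  hence "b \<in> set bs"
    using l by (metis nth_mem)
  thus ?thesis
    using bs unfolding covers_def published_lane_def by blast
qed

lemma coversD:
  assumes "covers E \<rho> b"
  shows "rauthor \<rho> = author b" "height b \<le> rheight \<rho>"
  using assms by (auto simp: covers_def lane_prefix_def in_set_conv_nth)

text \<open>Causality: a party can name a lane through \<open>b\<close> only after \<open>b\<close>
  was published. This is the source of the lower bounds on eligibility and latency.\<close>

lemma covers_direct_pub_sent:
  assumes "covers E \<rho> b" "direct_pub E i \<rho> k"
  shows "sent E (author b) (Publish b) k"
proof -
  obtain bs where bs: "published_lane \<rho> bs" "b \<in> set bs"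
    using assms(1) by (auto simp: covers_def published_lane_def)
  obtain cs where cs: "lane_prefix E \<rho> cs" "\<forall>b\<in>set cs. rcvd E i (rauthor \<rho>) (Publish b) k"
    using assms(2) by (auto simp: direct_pub_def)
  have "bs = take (rheight \<rho>) cs"
    using published_lane_unique[OF bs(1) direct_pub_published_lane[OF cs]] by simp
  hence "b \<in> set cs"
    using bs(2) in_set_takeD by fastforce
  thus ?thesis
    using cs rcvd_sent coversD(1)[OF assms(1)] by fastforce
qed

lemma publish_lane:
  assumes "ev E k = Bcast j (Publish b)"
  obtains bs where "lane_prefix E (block_ref E b) bs" "\<forall>b'\<in>set bs. sent E j (Publish b') (Suc k)"
proof -
  obtain bs where bs: "set bs = {b'. sent E j (Publish b') k}"
    "lane_prefix E (block_ref E b) (bs @ [b])"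
    using may_send[OF assms] by auto
  have "sent E j (Publish b') (Suc k)" if "b' \<in> set (bs @ [b])" for b'
    using that bs(1) assms by (auto simp: sent_def intro: less_SucI)
  with bs(2) that show thesis
    by blast
qed

lemma publish_height: "ev E k = Bcast j (Publish b) \<Longrightarrow> 1 \<le> height b"
  by (erule publish_lane) (auto simp: lane_prefix_def block_ref_def Suc_le_eq simp flip: length_greater_0_conv)

lemma block_direct_pub:
  assumes "ev E k = Bcast j (Publish b)" "tm E k \<le> s" "gst E \<le> s" "i \<in> parties E"
  shows "direct_pub E i (block_ref E b) (cut (s + delta E))"
proof -
  obtain bs where bs: "lane_prefix E (block_ref E b) bs"
    "\<forall>b'\<in>set bs. sent E j (Publish b') (Suc k)"
    using assms publish_lane by blast
  have "rcvd E i j (Publish b') (cut (s + delta E))" if b': "b' \<in> set bs" for b'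
  proof -
    obtain k' where "k' \<le> k" "ev E k' = Bcast j (Publish b')"
      using bs(2) b' by (auto simp: sent_def less_Suc_eq_le)
    thus ?thesis
      using rcvd_by assms tm_mono by (meson order.trans)
  qed
  moreover have "author b = j"
    using assms publish_author by blast
  ultimately show ?thesis
    using bs by (auto simp: direct_pub_def block_ref_def)
qed

lemma direct_pub_block_sent: "direct_pub E i (block_ref E b) k \<Longrightarrow> ev E k0 = Bcast j (Publish b) \<Longrightarrow> k0 < k"
proof -
  assume d: "direct_pub E i (block_ref E b) k" and e: "ev E k0 = Bcast j (Publish b)"
  have a: "author b = j"
    using e publish_author by blast
  have "covers E (block_ref E b) b"
    using covers_direct_pub[OF d] e a publish_height by (auto simp: block_ref_def)
  then obtain k' where "k' < k" "ev E k' = Bcast j (Publish b)"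
    using covers_direct_pub_sent d a unfolding sent_def by blast
  thus ?thesis
    using publish_unique(1)[OF e] by blast
qed

subsection \<open>Manifests and proposals\<close>

lemma finite_sent: "finite {m. sent E j m k}"
proof (rule finite_subset)
  show "{m. sent E j m k} \<subseteq> (\<lambda>k'. case ev E k' of Bcast _ m \<Rightarrow> m | _ \<Rightarrow> Wish 0) ` {..<k}"
    by (force simp: sent_def)
qed simp

text \<open>The height of a directly published reference is that of a block sent before
  \<open>k\<close>, and there are finitely many of these. Without this bound a manifest rule asking
  for the newest reference might select nothing.\<close>

lemma direct_pub_bounded: "\<exists>N. \<forall>\<rho>. rauthor \<rho> = a \<and> direct_pub E i \<rho> k \<longrightarrow> rheight \<rho> \<le> N"
proof -
  let ?H = "height ` {b. sent E a (Publish b) k}"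
  have "finite (Publish ` {b. sent E a (Publish b) k})"
    by (rule finite_subset[OF _ finite_sent[of a k]]) auto
  hence fin: "finite ?H"
    using finite_imageD[of Publish] by (auto simp: inj_on_def)
  have "rheight \<rho> \<le> Max ?H" if a: "rauthor \<rho> = a" "direct_pub E i \<rho> k" for \<rho>
  proof -
    obtain bs where bs: "lane_prefix E \<rho> bs" "\<forall>b\<in>set bs. rcvd E i (rauthor \<rho>) (Publish b) k"
      using a by (auto simp: direct_pub_def)
    let ?b = "bs ! (rheight \<rho> - 1)"
    have len: "rheight \<rho> - 1 < length bs" "1 \<le> rheight \<rho>" "length bs = rheight \<rho>"
      using bs direct_pub_height[OF a(2)] by (auto simp: lane_prefix_def)
    have "height ?b = rheight \<rho>"
      using bs len by (auto simp: lane_prefix_def)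
    moreover have "sent E a (Publish ?b) k"
      using bs(2) len(1) rcvd_sent a(1) nth_mem by blast
    ultimately have "rheight \<rho> \<in> ?H"
      by force
    thus ?thesis
      using fin by simp
  qed
  thus ?thesis
    by blast
qed

lemma newest_exists:
  assumes "P \<rho>\<^sub>0" "\<And>\<rho>. P \<rho> \<Longrightarrow> rauthor \<rho> = a \<and> direct_pub E i \<rho> k"
  obtains \<rho> where "P \<rho>" "\<And>\<sigma>. P \<sigma> \<Longrightarrow> rheight \<sigma> \<le> rheight \<rho>"
proof -
  obtain N where N: "\<forall>\<rho>. rauthor \<rho> = a \<and> direct_pub E i \<rho> k \<longrightarrow> rheight \<rho> \<le> N"
    using direct_pub_bounded by blast
  hence "\<forall>\<rho>. P \<rho> \<longrightarrow> rheight \<rho> < Suc N"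
    using assms(2) less_Suc_eq_le by blast
  from ex_has_greatest_nat[of P \<rho>\<^sub>0 rheight, OF assms(1) this] show thesis
    using that by blast
qed

lemma core_manifestD:
  "\<rho> \<in> core_manifest E i k \<Longrightarrow>
     rauthor \<rho> \<in> parties E \<and> direct_pub E i \<rho> k \<and> exact_available E (quorum E) i \<rho> k"
  by (simp add: core_manifest_def)

lemma tip_manifestD:
  "\<rho> \<in> tip_manifest E i k \<Longrightarrow> rauthor \<rho> \<in> parties E \<and> tip_candidate E i \<rho> k"
  by (simp add: tip_manifest_def inexact_candidate_def split: if_splits)

lemma tip_manifest_direct_pub: "\<rho> \<in> tip_manifest E i k \<Longrightarrow> direct_pub E i \<rho> k"
  by (auto dest: tip_manifestD simp: tip_candidate_def)

lemma wf_core_manifest: "wf_manifest E (core_manifest E i k)"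
proof -
  have "\<rho> = \<sigma>" if "\<rho> \<in> core_manifest E i k" "\<sigma> \<in> core_manifest E i k" "rauthor \<rho> = rauthor \<sigma>" for \<rho> \<sigma>
  proof -
    have "rheight \<rho> = rheight \<sigma>"
      using that by (auto simp: core_manifest_def intro: order.antisym)
    thus ?thesis
      using that core_manifestD direct_pub_eq by meson
  qed
  thus ?thesis
    using core_manifestD direct_pub_height unfolding wf_manifest_def by blast
qed

lemma wf_tip_manifest: "wf_manifest E (tip_manifest E i k)"
proof -
  have "\<rho> = \<sigma>" if "\<rho> \<in> tip_manifest E i k" "\<sigma> \<in> tip_manifest E i k" "rauthor \<rho> = rauthor \<sigma>" for \<rho> \<sigma>
  proof -
    have "rheight \<rho> = rheight \<sigma>"
      using that by (auto simp: tip_manifest_def split: if_splits intro: order.antisym)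
    thus ?thesis
      using that tip_manifest_direct_pub direct_pub_eq by meson
  qed
  thus ?thesis
    using tip_manifestD tip_manifest_direct_pub direct_pub_height unfolding wf_manifest_def by blast
qed

lemma proposesD:
  assumes "proposes E v B k"
  shows "1 \<le> v" "B = (core_manifest E (proposer E v) k, tip_manifest E (proposer E v) k)"
    "\<not> (\<exists>B'. sent E (proposer E v) (Proposal v B') k)"
  using may_send[of k "proposer E v" "Proposal v B"] assms
  by (auto simp: proposes_def propose_enabled_def)

lemma proposes_unique:
  assumes "proposes E v B k" "proposes E v B' k'"
  shows "k = k'" "B = B'"
proof -
  have "\<not> k < k'" if "proposes E v B k" "proposes E v B' k'" for k k' B B'
    using proposesD(3)[OF that(2)] that(1) unfolding sent_def proposes_def by metis
  thus "k = k'"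
    using assms by (meson nat_neq_iff)
  thus "B = B'"
    using assms by (simp add: proposes_def)
qed

lemma beta_eq: "proposes E v B k \<Longrightarrow> beta E v = tm E k"
proof -
  assume p: "proposes E v B k"
  have "(LEAST k. \<exists>B. proposes E v B k) = k"
  proof (rule Least_equality)
    show "\<exists>B. proposes E v B k"
      using p by blast
    show "k \<le> k'" if "\<exists>B. proposes E v B k'" for k'
      using that proposes_unique(1)[OF p] by blast
  qed
  thus ?thesis
    by (simp add: beta_def)
qed

lemma wf_proposes: "proposes E v B k \<Longrightarrow> wf_proposal E B"
  using proposesD(2) wf_core_manifest wf_tip_manifest
  unfolding wf_proposal_def by (metis fst_conv snd_conv)

lemma proposes_direct_pub:
  "proposes E v B k \<Longrightarrow> \<rho> \<in> fst B \<union> snd B \<Longrightarrow> direct_pub E (proposer E v) \<rho> k"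
proof -
  assume "proposes E v B k" "\<rho> \<in> fst B \<union> snd B"
  hence "\<rho> \<in> core_manifest E (proposer E v) k \<or> \<rho> \<in> tip_manifest E (proposer E v) k"
    using proposesD(2) by (metis Un_iff fst_conv snd_conv)
  thus ?thesis
    using core_manifestD tip_manifest_direct_pub by blast
qed

text \<open>Direct receipt settles every \<open>author_ok\<close>. For anchoring, the proposer chose
  the tip strictly above its core entry, and on an unforked lane the lower prefix is an initial part
  of the higher one.\<close>

lemma proposes_ok:
  assumes "proposes E v B k0" "\<And>\<rho>. \<rho> \<in> fst B \<union> snd B \<Longrightarrow> direct_pub E i \<rho> k"
  shows "core_ok E i (fst B) k" "tip_ok E i (fst B) (snd B) k"
proof -
  have "ancestor E i \<kappa> \<rho> k \<and> rheight \<kappa> < rheight \<rho>"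
    if m: "\<rho> \<in> snd B" "\<kappa> \<in> fst B" and a: "rauthor \<kappa> = rauthor \<rho>" for \<rho> \<kappa>
  proof
    have "tip_candidate E (proposer E v) \<rho> k0" "\<kappa> \<in> core_manifest E (proposer E v) k0"
      using that proposesD(2)[OF assms(1)] by (simp_all add: tip_manifestD)
    thus h: "rheight \<kappa> < rheight \<rho>"
      using a by (simp add: tip_candidate_def)
    obtain cs bs where
      cs: "lane_prefix E \<kappa> cs" "\<forall>b\<in>set cs. rcvd E i (rauthor \<kappa>) (Publish b) k" and
      bs: "lane_prefix E \<rho> bs" "\<forall>b\<in>set bs. rcvd E i (rauthor \<rho>) (Publish b) k"
      using assms(2)[of \<kappa>] assms(2)[of \<rho>] m by (auto simp: direct_pub_def)
    have "cs = take (rheight \<kappa>) bs"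
      using published_lane_unique[OF direct_pub_published_lane[OF cs] direct_pub_published_lane[OF bs] a]
        h by simp
    thus "ancestor E i \<kappa> \<rho> k"
      using cs(1) bs a h unfolding ancestor_def holds_prefix_iff by (intro exI[of _ bs]) simp
  qed
  thus "core_ok E i (fst B) k" "tip_ok E i (fst B) (snd B) k"
    using assms(2) by (simp_all add: core_ok_def tip_ok_def author_ok_def tip_anchored_def
        holds_iff_direct_pub)
qed

lemma fixed_proposes: "fixed E i v B k \<Longrightarrow> \<exists>k'<k. proposes E v B k'"
  using receives_sent unfolding fixed_def fixes_at_def proposes_def by (metis le_less_trans)

lemma fixed_mono: "k \<le> k' \<Longrightarrow> fixed E i v B k \<Longrightarrow> fixed E i v B k'"
  by (auto simp: fixed_def intro: less_le_trans)

text \<open>The proposal that is fixed is the first one received, but the proposer sends only one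
  per view, so any received one is it.\<close>

lemma rcvd_fixed:
  assumes "rcvd E i (proposer E v) (Proposal v B) k"
  shows "fixed E i v B k"
proof -
  let ?P = "\<lambda>k'. \<exists>B'. receives E i (proposer E v) (Proposal v B') k'"
  obtain k' where k': "k' < k" "receives E i (proposer E v) (Proposal v B) k'"
    using assms by (auto simp: rcvd_def)
  define k1 where "k1 = (LEAST k'. ?P k')"
  have "?P k1" "k1 \<le> k'"
    unfolding k1_def using k'(2) LeastI[of ?P k'] Least_le[of ?P k'] by blast+
  then obtain B1 where B1: "receives E i (proposer E v) (Proposal v B1) k1"
    by blast
  obtain l l' where "proposes E v B1 l" "proposes E v B l'"
    using receives_sent[OF B1] receives_sent[OF k'(2)] unfolding proposes_def by blast
  hence "B1 = B"
    by (rule proposes_unique)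
  moreover have "\<not> ?P k''" if "k'' < k1" for k''
    using that not_less_Least unfolding k1_def by blast
  ultimately show ?thesis
    using B1 \<open>k1 \<le> k'\<close> \<open>k' < k\<close> unfolding fixed_def fixes_at_def by (meson le_less_trans)
qed

lemma fixed_by:
  assumes "proposes E v B k" "tm E k \<le> s" "gst E \<le> s" "i \<in> parties E"
  shows "fixed E i v B (cut (s + delta E))"
  using rcvd_fixed rcvd_by assms unfolding proposes_def by blast

lemma refs_direct_pub_by:
  assumes "proposes E v B k" "tm E k \<le> s" "gst E \<le> s" "i \<in> parties E" "\<rho> \<in> fst B \<union> snd B"
  shows "direct_pub E i \<rho> (cut (s + delta E))"
proof (rule direct_pub_spread[OF proposes_direct_pub[OF assms(1,5)]])
  show "tm E k' \<le> s" if "k' < k" for k'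
    using that tm_mono[of k' k] assms(2) by linarith
qed (use assms in auto)

subsection \<open>The responsive frontier\<close>

text \<open>\<open>frontier\<close> is a \<open>Max\<close> and is meaningful only over a finite
  set. Each value other than 0 is named by an event before \<open>k\<close>, from which
  \<open>?view\<close> reads it.\<close>

lemma finite_frontier: "finite {a. frontier_value E i k a}"
proof (rule finite_subset)
  let ?view = "\<lambda>e. case e of Enter _ v \<Rightarrow> v - 1 | Bcast _ (Proposal v _) \<Rightarrow> v
    | Deliver _ _ (Proposal v _) \<Rightarrow> v | _ \<Rightarrow> (0::nat)"
  show "{a. frontier_value E i k a} \<subseteq> insert 0 ((\<lambda>k'. ?view (ev E k')) ` {..<k})"
  proof
    fix a assume "a \<in> {a. frontier_value E i k a}"
    hence "frontier_value E i k a"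
      by simp
    thus "a \<in> insert 0 ((\<lambda>k'. ?view (ev E k')) ` {..<k})"
    proof cases
      case (enter v)
      then obtain k' where "k' < k" "ev E k' = Enter i v"
        by (auto simp: entered_def)
      thus ?thesis
        using enter by (intro insertI2 image_eqI[of _ _ k']) auto
    next
      case (step a' B)
      then obtain k' where "k' < k" "receives E i (proposer E a) (Proposal a B) k'"
        by (auto simp: fixed_def fixes_at_def)
      thus ?thesis
        by (intro insertI2 image_eqI[of _ _ k']) (auto simp: receives_def)
    qed simp
  qed
qed simp

lemma frontier_ge: "frontier_value E i k a \<Longrightarrow> a \<le> frontier E i k"
  unfolding frontier_def using finite_frontier by simp

text \<open>Receipt alone carries the frontier from \<open>start\<close> upwards, without any entry.
  This is what detaches the pace of proposals from the pacemaker.\<close>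

lemma frontier_if_fixed:
  assumes "\<And>u. 1 \<le> u \<Longrightarrow> u \<le> v \<Longrightarrow> \<exists>B. fixed E i u B k"
  shows "v \<le> frontier E i k"
proof -
  have "frontier_value E i k v"
    using assms
  proof (induction v)
    case 0
    show ?case
      by (rule frontier_value.start)
  next
    case (Suc v)
    obtain B where B: "fixed E i (Suc v) B k"
      using Suc.prems by fastforce
    moreover have "wf_proposal E B"
      using fixed_proposes[OF B] wf_proposes by blast
    moreover have "frontier_value E i k v"
      using Suc by simp
    ultimately show ?case
      using frontier_value.step by blast
  qed
  thus ?thesis
    by (rule frontier_ge)
qed

lemma proposed_by_cut:
  assumes "0 < cut \<tau>" "1 \<le> v" "v - 1 \<le> frontier E (proposer E v) (cut \<tau>)"
  shows "proposed_by E v \<tau>"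
proof -
  have "\<exists>B. sent E (proposer E v) (Proposal v B) (cut \<tau>)"
    using settled_cut(1)[OF proposer_in_parties assms(1)] assms
    unfolding propose_enabled_def by blast
  thus ?thesis
    by (auto simp: proposed_by_def proposes_def sent_def less_cut_iff)
qed

subsection \<open>Responses and seals\<close>

lemma echo_fixed: "ev E k = Bcast i (Echo v g B cl) \<Longrightarrow> fixed E i v B k \<and> cl = claims E i B k"
  by (drule may_send) (auto simp: full_echo_enabled_def soft_timeout_def active_def)

lemma echo_not_done: "ev E k = Bcast i m \<Longrightarrow> echo_resp v m \<Longrightarrow> \<not> echo_done E i v k"
  by (drule may_send) (cases m, auto)

lemma echo_unique:
  assumes "ev E k = Bcast i m" "ev E k' = Bcast i m'" "echo_resp v m" "echo_resp v m'"
  shows "k = k'"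
proof -
  have "\<not> k < k'" if "ev E k = Bcast i m" "ev E k' = Bcast i m'" "echo_resp v m" "echo_resp v m'"
    for k k' m m'
    using echo_not_done[OF that(2,4)] that(1,3) by (auto simp: echo_done_def sent_def)
  thus ?thesis
    using assms by (meson nat_neq_iff)
qed

lemma rcvd_echo_proposes: "rcvd E i j (Echo v g B cl) k \<Longrightarrow> \<exists>k'<k. proposes E v B k'"
proof -
  assume "rcvd E i j (Echo v g B cl) k"
  then obtain k' where k': "k' < k" "ev E k' = Bcast j (Echo v g B cl)"
    using rcvd_sent unfolding sent_def by blast
  then obtain k'' where "k'' < k'" "proposes E v B k''"
    using echo_fixed fixed_proposes by blast
  thus ?thesis
    using k'(1) less_trans by blast
qed

lemma ready_proposes:
  assumes "ev E k = Bcast i (Ready v g B)"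
  shows "\<exists>k'<k. proposes E v B k'"
proof -
  have "ready_enabled E i v B k \<or> refine_allowed E i v g B k"
    using may_send[OF assms] by auto
  hence "\<exists>j\<in>parties E. \<exists>g cl. rcvd E i j (Echo v g B cl) k"
  proof
    assume "ready_enabled E i v B k"
    thus ?thesis
      using quorum_witness[of "\<lambda>j. \<exists>g cl. rcvd E i j (Echo v g B cl) k"]
      by (simp add: ready_enabled_def echo_count_any_def)
  next
    assume "refine_allowed E i v g B k"
    hence "\<exists>j\<in>parties E. \<exists>cl. rcvd E i j (Echo v g B cl) k"
      using quorum_witness[of "\<lambda>j. \<exists>cl. rcvd E i j (Echo v g B cl) k"]
      by (simp add: refine_allowed_def echo_count_def)
    thus ?thesis
      by blast
  qed
  thus ?thesis
    using rcvd_echo_proposes by blast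
qed

lemma rcvd_ready_proposes: "rcvd E i j (Ready v g B) k \<Longrightarrow> \<exists>k'<k. proposes E v B k'"
proof -
  assume "rcvd E i j (Ready v g B) k"
  then obtain k' where k': "k' < k" "ev E k' = Bcast j (Ready v g B)"
    using rcvd_sent unfolding sent_def by blast
  then obtain k'' where "k'' < k'" "proposes E v B k''"
    using ready_proposes by blast
  thus ?thesis
    using k'(1) less_trans by blast
qed

lemma seal_proposes:
  assumes "seal_condition E R i v d k"
  shows "\<exists>C T k'. k' < k \<and> proposes E v (C, T) k' \<and> (d = Commit_Full C T \<or> d = Commit_Core C)"
proof -
  have ready: "\<exists>j. rcvd E i j (Ready v g B) k" if "quorum E \<le> ready_count E i v g B k" for g B
    using quorum_witness[of "\<lambda>j. rcvd E i j (Ready v g B) k"] that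
    by (auto simp: ready_count_def)
  obtain j0 where j0: "j0 \<in> parties E"
    using parties_nonempty by blast
  consider C T cl where "d = Commit_Full C T" "rcvd E i j0 (Echo v G1 (C, T) cl) k"
    | C T where "d = Commit_Full C T" "quorum E \<le> ready_count E i v G1 (C, T) k"
    | C T where "d = Commit_Core C" "quorum E \<le> ready_count E i v G0 (C, T) k"
    using assms j0 unfolding seal_condition_def by blast
  thus ?thesis
  proof cases
    case 1
    thus ?thesis
      using rcvd_echo_proposes[OF 1(2)] by blast
  next
    case 2
    thus ?thesis
      using ready[OF 2(2)] rcvd_ready_proposes by blast
  next
    case 3
    thus ?thesis
      using ready[OF 3(2)] rcvd_ready_proposes by blast
  qed
qed

lemma sealed_mono: "k \<le> k' \<Longrightarrow> sealed E R i v d k \<Longrightarrow> sealed E R i v d k'"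
  unfolding sealed_def by (meson order.trans)

text \<open>The first seal is kept, so a satisfied condition only shows that some seal exists,
  perhaps an earlier and different one. In the suffix \<open>sealed_full\<close> identifies
  it.\<close>

lemma sealed_exists:
  assumes "seal_condition E R i v d k"
  shows "\<exists>d'. sealed E R i v d' k"
proof -
  define k0 where "k0 = (LEAST k. \<exists>d'. seal_condition E R i v d' k)"
  have "\<exists>d'. seal_condition E R i v d' k0" "k0 \<le> k"
    unfolding k0_def using assms LeastI[of "\<lambda>k. \<exists>d'. seal_condition E R i v d' k" k]
      Least_le[of "\<lambda>k. \<exists>d'. seal_condition E R i v d' k" k] by blast+
  moreover have "\<not> seal_condition E R i v d' k'" if "k' < k0" for k' d'
    using that not_less_Least unfolding k0_def by blast
  ultimately show ?thesis
    unfolding sealed_def by blast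
qed

lemma sealed_proposes:
  assumes "sealed E R i v d k"
  shows "\<exists>C T k'. k' < k \<and> proposes E v (C, T) k' \<and> (d = Commit_Full C T \<or> d = Commit_Core C)"
  using assms seal_proposes unfolding sealed_def by (meson less_le_trans)

lemma processed_mono: "k \<le> k' \<Longrightarrow> processed E r R i v k \<Longrightarrow> processed E r R i v k'"
  unfolding processed_def using sealed_mono[of k k'] holds_mono[of k k'] by meson

lemma sequenced_after_publish:
  assumes "sequenced_at E r R cov i b k" "\<And>d. cov d \<subseteq> named_refs d" "ev E k0 = Bcast j (Publish b)"
  shows "k0 < k"
proof -
  obtain v d \<rho> where d: "sealed E (rules_from r R v) i v d k" "\<rho> \<in> cov d" "covers E \<rho> b"
    using assms(1) by (auto simp: sequenced_at_def)
  obtain C T k' where B: "k' < k" "proposes E v (C, T) k'" "d = Commit_Full C T \<or> d = Commit_Core C"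
    using sealed_proposes[OF d(1)] by blast
  hence "\<rho> \<in> fst (C, T) \<union> snd (C, T)"
    using d(2) assms(2)[of d] by auto
  hence "sent E (author b) (Publish b) k'"
    using covers_direct_pub_sent[OF d(3)] proposes_direct_pub[OF B(2)] by blast
  thus ?thesis
    using B(1) publish_unique(1)[OF assms(3)] publish_author[OF assms(3)]
    unfolding sent_def by (metis less_trans)
qed

subsection \<open>Catching up within \<open>\<delta>\<close>\<close>

lemma cut_le: "\<tau> < tm E k \<Longrightarrow> cut \<tau> \<le> k"
  using less_cut_iff[of k \<tau>] by simp

text \<open>At the cut every conjunct of the full ECHO rule holds except that the response is
  pending; no rule is enabled there, so it has been sent. Activation by entry serves against the
  timeouts, activation by the frontier gives the responsive bounds.\<close>

lemma echo_done_by: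
  assumes "proposes E v B k" "tm E k \<le> s" "gst E \<le> s" "i \<in> parties E"
    and "entered E i v (cut (s + delta E)) \<or> v \<le> frontier E i (cut (s + delta E))"
  shows "echo_done E i v (cut (s + delta E))"
proof -
  have "active E i v B (cut (s + delta E))"
    using fixed_by[OF assms(1-4)] wf_proposes[OF assms(1)] assms(5) by (simp add: active_def)
  moreover have "core_ok E i (fst B) (cut (s + delta E))" "tip_ok E i (fst B) (snd B) (cut (s + delta E))"
    using proposes_ok[OF assms(1) refs_direct_pub_by[OF assms(1-4)]] by blast+
  moreover have "k < cut (s + delta E)"
    using assms(2) delta_pos by (simp add: less_cut_iff)
  ultimately show ?thesis
    using settled_cut(2)[OF assms(4)] unfolding full_echo_enabled_def by (metis gr_zeroI not_less0)
qed

lemma proposed_by_iff: "proposes E v B k \<Longrightarrow> proposed_by E v s \<longleftrightarrow> tm E k \<le> s"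
  using proposes_unique(1) unfolding proposed_by_def by blast

lemma frontier_by:
  assumes "gst E \<le> s" "i \<in> parties E" "\<And>u. 1 \<le> u \<Longrightarrow> u \<le> v \<Longrightarrow> proposed_by E u s"
  shows "v \<le> frontier E i (cut (s + delta E))"
proof (rule frontier_if_fixed)
  fix u assume "1 \<le> u" "u \<le> v"
  then obtain B k where "proposes E u B k" "tm E k \<le> s"
    using assms(3) unfolding proposed_by_def by blast
  thus "\<exists>B. fixed E i u B (cut (s + delta E))"
    using fixed_by assms(1,2) by blast
qed

lemma coverable_covers:
  assumes "proposes E v B k" "ev E k0 = Bcast a (Publish b)"
    and "direct_pub E (proposer E v) (block_ref E b) k" "coverable E (proposer E v) b k"
  shows "\<exists>\<rho>\<in>fst B \<union> snd B. covers E \<rho> b"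
proof (rule ccontr)
  let ?i = "proposer E v"
  assume none: "\<not> ?thesis"
  have B: "B = (core_manifest E ?i k, tip_manifest E ?i k)"
    using proposesD(2)[OF assms(1)] .
  have a: "author b = a" "1 \<le> height b"
    using publish_author publish_height assms(2) by blast+
  have covers: "covers E \<rho> b" if "direct_pub E ?i \<rho> k" "rauthor \<rho> = author b" "height b \<le> rheight \<rho>" for \<rho>
    using covers_direct_pub[of ?i \<rho> k k0 b] that assms(2) a by simp
  have q: "\<not> quarantined E ?i (author b) k"
    and inexact: "\<And>\<sigma>. rauthor \<sigma> = author b \<Longrightarrow> inexact_candidate E ?i \<sigma> k \<Longrightarrow> height b \<le> rheight \<sigma>"
    using assms(4) none B unfolding coverable_def by auto
  have "rheight \<kappa> < height b" if "\<kappa> \<in> core_manifest E ?i k" "rauthor \<kappa> = author b" for \<kappa>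
    using covers[of \<kappa>] core_manifestD[OF that(1)] that none B by fastforce
  hence cand: "tip_candidate E ?i (block_ref E b) k"
    using assms(3) by (simp add: tip_candidate_def block_ref_def)
  have party: "author b \<in> parties E"
    using direct_pub_author[OF assms(3)] by (simp add: block_ref_def)
  have dp: "rauthor \<rho> = author b \<and> direct_pub E ?i \<rho> k"
    if "rauthor \<rho> = author b \<and> tip_candidate E ?i \<rho> k" for \<rho>
    using that by (simp add: tip_candidate_def)
  show False
  proof (cases "\<exists>\<sigma>. rauthor \<sigma> = author b \<and> inexact_candidate E ?i \<sigma> k")
    case True
    then obtain \<rho> where \<rho>: "rauthor \<rho> = author b" "inexact_candidate E ?i \<rho> k"
      "\<And>\<sigma>. rauthor \<sigma> = author b \<and> inexact_candidate E ?i \<sigma> k \<Longrightarrow> rheight \<rho> \<le> rheight \<sigma>"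
      using ex_has_least_nat[of "\<lambda>\<sigma>. rauthor \<sigma> = author b \<and> inexact_candidate E ?i \<sigma> k" _ rheight]
      by blast
    hence "\<rho> \<in> tip_manifest E ?i k"
      using q party by (auto simp: tip_manifest_def)
    moreover have "covers E \<rho> b"
      using covers[of \<rho>] \<rho>(1,2) inexact by (simp add: inexact_candidate_def tip_candidate_def)
    ultimately show False
      using none B by auto
  next
    case False
    obtain \<rho> where \<rho>: "rauthor \<rho> = author b \<and> tip_candidate E ?i \<rho> k"
      "\<And>\<sigma>. rauthor \<sigma> = author b \<and> tip_candidate E ?i \<sigma> k \<Longrightarrow> rheight \<sigma> \<le> rheight \<rho>"
      using newest_exists[of "\<lambda>\<sigma>. rauthor \<sigma> = author b \<and> tip_candidate E ?i \<sigma> k" "block_ref E b"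
          "author b" ?i k] cand dp by (auto simp: block_ref_def)
    hence "\<rho> \<in> tip_manifest E ?i k"
      using False q party by (auto simp: tip_manifest_def)
    moreover have "height b \<le> rheight \<rho>"
      using \<rho>(2)[of "block_ref E b"] cand by (simp add: block_ref_def)
    hence "covers E \<rho> b"
      using covers dp[OF \<rho>(1)] by blast
    ultimately show False
      using none B by auto
  qed
qed

text \<open>The core takes the newest exactly available reference. It may differ from
  \<open>\<rho>\<close> but is at least as high, hence still covers \<open>b\<close>.\<close>

lemma exact_available_covers:
  assumes "proposes E v B k" "ev E k0 = Bcast a (Publish b)" "covers E \<rho> b"
    and "direct_pub E (proposer E v) \<rho> k" "exact_available E (quorum E) (proposer E v) \<rho> k"
  shows "\<exists>\<kappa>\<in>fst B. covers E \<kappa> b"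
proof -
  let ?i = "proposer E v"
  let ?P = "\<lambda>\<sigma>. rauthor \<sigma> = author b \<and> direct_pub E ?i \<sigma> k \<and> exact_available E (quorum E) ?i \<sigma> k"
  have "?P \<rho>"
    using assms coversD(1) by blast
  then obtain \<kappa> where \<kappa>: "?P \<kappa>" "\<And>\<sigma>. ?P \<sigma> \<Longrightarrow> rheight \<sigma> \<le> rheight \<kappa>"
    using newest_exists[of ?P \<rho> "author b" ?i k] by blast
  have "\<kappa> \<in> core_manifest E ?i k"
    using \<kappa> direct_pub_author[of ?i \<kappa> k] by (auto simp: core_manifest_def)
  moreover have "height b \<le> rheight \<kappa>"
    using \<kappa>(2)[OF \<open>?P \<rho>\<close>] coversD(2)[OF assms(3)] by simp
  hence "covers E \<kappa> b"
    using covers_direct_pub[of ?i \<kappa> k k0 b] \<kappa>(1) assms(2) publish_author[OF assms(2)]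
      publish_height[OF assms(2)] by simp
  ultimately show ?thesis
    using proposesD(2)[OF assms(1)] by auto
qed

end

section \<open>Responsive suffixes\<close>

locale responsive_run =
  fixes E :: "('tx, 'h) execution" and r :: nat
  assumes suffix: "responsive_suffix E r"
begin

sublocale vantage_execution E
  using suffix by unfold_locales (simp add: responsive_suffix_def)

subsection \<open>All echoes and readies of the suffix have grade 1\<close>

lemma gst_le_proposal: "proposes E v B k \<Longrightarrow> r \<le> v \<Longrightarrow> gst E \<le> tm E k"
  using suffix unfolding responsive_suffix_def pacemaker_cutoff_def proposes_def
  by (meson leD not_le order.trans)

lemma gst_le_enter: "ev E k = Enter i v \<Longrightarrow> r \<le> v \<Longrightarrow> gst E \<le> tm E k"
  using suffix unfolding responsive_suffix_def pacemaker_cutoff_def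
  by (meson leD not_le order.trans)

lemma entry_near:
  assumes "r \<le> v" "i \<in> parties E" "ev E ke = Enter j v"
  shows "entered E i v (cut (tm E ke + delta E))"
proof -
  obtain k where "ev E k = Enter i v" "tm E k \<le> tm E ke + delta E"
    using suffix assms unfolding responsive_suffix_def pacemaker_cutoff_def
    by (meson order.trans)
  thus ?thesis
    by (auto simp: entered_def less_cut_iff)
qed

text \<open>Entering \<open>v\<close> lifts the proposer's frontier to \<open>v - 1\<close>, which
  suffices for proposing even if lower proposals are still missing; and the proposer enters at most
  \<open>delta E\<close> after any other party.\<close>

lemma proposed_after_entry:
  assumes "r \<le> v" "ev E ke = Enter i v"
  obtains B k where "proposes E v B k" "tm E k \<le> tm E ke + delta E"
proof -
  let ?c = "cut (tm E ke + delta E)"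
  have "v - 1 \<le> frontier E (proposer E v) ?c"
    using frontier_ge frontier_value.enter entry_near[OF assms(1) proposer_in_parties assms(2)] by blast
  moreover have "ke < ?c"
    using delta_pos by (simp add: less_cut_iff)
  moreover have "1 \<le> v"
    using suffix assms(1) by (simp add: responsive_suffix_def)
  ultimately show thesis
    using proposed_by_cut[of "tm E ke + delta E" v] that by (auto simp: proposed_by_def)
qed

text \<open>A deadline requires \<open>settled\<close>. By then the named lanes have arrived and the
  full ECHO would be enabled, a contradiction. The inequality \<open>due\<close> need not be strict,
  so arrival is argued at the deadline position and not through \<open>cut\<close>.\<close>

lemma no_soft_timeout:
  assumes "r \<le> v" "i \<in> parties E" "\<not> echo_done E i v k"
  shows "\<not> soft_timeout E i v B k"
proof
  assume timeout: "soft_timeout E i v B k"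
  then obtain ke kr where k: "ke < k" "kr < k" "ev E ke = Enter i v" "fixes_at E i v B kr"
    and dl: "at_deadline E i (soft_echo_limit E i ke kr) k"
    by (auto simp: soft_timeout_def)
  obtain kb where kb: "kb \<le> kr" "proposes E v B kb"
    using k(4) receives_sent unfolding fixes_at_def proposes_def by blast
  obtain kb' B' where "proposes E v B' kb'" "tm E kb' \<le> tm E ke + delta E"
    using proposed_after_entry[OF assms(1) k(3)] by blast
  hence beta: "tm E kb \<le> tm E ke + delta E"
    using proposes_unique(1)[OF kb(2)] by blast
  have gst: "gst E \<le> tm E kb" "gst E \<le> tm E ke" "gst E \<le> tm E kr"
    using gst_le_proposal[OF kb(2) assms(1)] gst_le_enter[OF k(3) assms(1)] tm_mono[OF kb(1)] by auto
  have t: "tm E ke \<le> tm E k" "tm E kr \<le> tm E k" "tm E kb \<le> tm E kr"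
    using k(1,2) kb(1) by (auto intro: tm_mono)
  have "clock E i (tm E k) = clock E i (tm E ke) + (tm E k - tm E ke)"
    "clock E i (tm E k) = clock E i (tm E kr) + (tm E k - tm E kr)"
    using clock_diff[OF assms(2) gst(2) t(1)] clock_diff[OF assms(2) gst(3) t(2)] by blast+
  moreover have "clock E i (tm E k) = soft_echo_limit E i ke kr"
    using dl by (simp add: at_deadline_def)
  \<comment> \<open>Both arguments of the \<open>min\<close> in the limit are late enough: receipt
    is not before sending, so one \<open>Delta E\<close> after receipt suffices; and sending is at
    most \<open>delta E\<close> after entry, so \<open>3 * Delta E\<close> after entry
    suffices.\<close>
  ultimately have due: "tm E kb + delta E \<le> tm E k"
    using beta t delta_le delta_pos unfolding soft_echo_limit_def by linarith
  have "direct_pub E i \<rho> k" if "\<rho> \<in> fst B \<union> snd B" for \<rho>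
  proof (rule direct_pub_at_deadline[OF proposes_direct_pub[OF kb(2) that] _ _ dl assms(2)])
    show "kb \<le> k"
      using kb(1) k(2) by simp
    show "max (tm E k') (gst E) + delta E \<le> tm E k" if "k' < kb" for k'
      using that tm_mono[of k' kb] gst(1) due by simp
  qed
  hence "full_echo_enabled E i v B k"
    using proposes_ok[OF kb(2)] assms(3) timeout
    unfolding full_echo_enabled_def soft_timeout_def by blast
  thus False
    using dl unfolding at_deadline_def settled_def by blast
qed

lemma no_hard_timeout:
  assumes "r \<le> v" "i \<in> parties E"
  shows "\<not> hard_timeout E i v k"
proof
  assume timeout: "hard_timeout E i v k"
  then obtain ke where k: "ke < k" "ev E ke = Enter i v" and dl: "at_deadline E i (echo_limit E i ke) k"
    by (auto simp: hard_timeout_def)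
  obtain B kb where kb: "proposes E v B kb" "tm E kb \<le> tm E ke + delta E"
    using proposed_after_entry[OF assms(1) k(2)] .
  have "clock E i (tm E k) = clock E i (tm E ke) + (tm E k - tm E ke)"
    by (rule clock_diff[OF assms(2) gst_le_enter[OF k(2) assms(1)]]) (use k(1) tm_mono in simp)
  \<comment> \<open>The slack is strict here, two delays after entry against
    \<open>3 * Delta E\<close>, so the state at \<open>cut\<close> can be used.\<close>
  hence "tm E kb + delta E < tm E k"
    using dl kb(2) delta_le delta_pos unfolding at_deadline_def echo_limit_def by linarith
  hence "fixed E i v B k"
    using fixed_mono[OF cut_le] fixed_by[OF kb(1) order.refl gst_le_proposal[OF kb(1) assms(1)] assms(2)]
    by blast
  moreover have "entered E i v k"
    using k by (auto simp: entered_def)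
  ultimately show False
    using timeout wf_proposes[OF kb(1)] unfolding hard_timeout_def active_def by blast
qed

lemma echo_full:
  assumes "r \<le> v" "ev E k = Bcast i m" "echo_resp v m"
  obtains B cl where "m = Echo v G1 B cl" "full_echo_enabled E i v B k"
proof -
  have i: "i \<in> parties E" and m: "may_send E i m k"
    using may_send[OF assms(2)] by auto
  note no = no_soft_timeout[OF assms(1) i echo_not_done[OF assms(2,3)]] no_hard_timeout[OF assms(1) i]
  show thesis
    using m assms(3) no that by (cases m) auto
qed

lemma echo_by:
  assumes "r \<le> v" "proposes E v B k" "tm E k \<le> s" "i \<in> parties E"
    and "entered E i v (cut (s + delta E)) \<or> v \<le> frontier E i (cut (s + delta E))"
  obtains k' cl where "ev E k' = Bcast i (Echo v G1 B cl)" "tm E k' \<le> s + delta E"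
proof -
  have "gst E \<le> s"
    using gst_le_proposal[OF assms(2,1)] assms(3) by simp
  hence "echo_done E i v (cut (s + delta E))"
    using echo_done_by assms by blast
  moreover have "v \<noteq> 0"
    using proposesD(1)[OF assms(2)] by simp
  ultimately obtain k' m where k': "k' < cut (s + delta E)" "ev E k' = Bcast i m" "echo_resp v m"
    by (auto simp: echo_done_def sent_def)
  then obtain B' cl where m: "m = Echo v G1 B' cl"
    using echo_full[OF assms(1)] by blast
  then obtain kb where "proposes E v B' kb"
    using echo_fixed fixed_proposes k'(2) by blast
  hence "B' = B"
    using proposes_unique(2)[OF assms(2)] by blast
  thus thesis
    using that k' m by (simp add: less_cut_iff)
qed

lemma rcvd_echo_full:
  assumes "r \<le> v" "rcvd E i j (Echo v g B cl) k"
  shows "g = G1"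
proof -
  obtain k' where "ev E k' = Bcast j (Echo v g B cl)"
    using rcvd_sent[OF assms(2)] by (auto simp: sent_def)
  thus ?thesis
    using echo_full[OF assms(1)] by (metis echo_resp.simps(1) msg.inject(3))
qed

lemma ready_enabled_count:
  assumes "r \<le> v" "ready_enabled E i v B k"
  shows "quorum E \<le> echo_count E i v G1 B k"
proof -
  have "{j \<in> parties E. \<exists>g cl. rcvd E i j (Echo v g B cl) k} =
      {j \<in> parties E. \<exists>cl. rcvd E i j (Echo v G1 B cl) k}"
    using rcvd_echo_full[OF assms(1)] by blast
  thus ?thesis
    using assms(2) by (simp add: ready_enabled_def echo_count_def echo_count_any_def)
qed

text \<open>A mix READY needs a quorum of ECHOs without a grade-1 quorum, but all ECHOs counted here
  have grade 1. Since refinement presupposes a mix READY, no refinement occurs either.\<close>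

lemma ready_not_mix: "r \<le> v \<Longrightarrow> ev E k = Bcast i (Ready v GMix B) \<Longrightarrow> False"
  using ready_enabled_count[of v i B k] may_send[of k i "Ready v GMix B"]
  by (auto simp: refine_allowed_def split: if_splits)

text \<open>Counted from one entry, all parties enter and the proposal is sent within one delay, all
  have ECHOed within two, and all ECHOs are received within three, strictly before
  \<open>4 * Delta E\<close>. Activation is by entry, as lower proposals are not known to have been
  sent.\<close>

lemma no_no_ready:
  assumes "r \<le> v"
  shows "ev E k \<noteq> Bcast i (No_Ready v)"
proof
  assume e: "ev E k = Bcast i (No_Ready v)"
  have i: "i \<in> parties E"
    using may_send[OF e] by blast
  have "may_send E i (No_Ready v) k"
    using may_send[OF e] by blast
  then obtain ke where k: "ke < k" "ev E ke = Enter i v" and dl: "at_deadline E i (ready_limit E i ke) k"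
    and nd: "\<not> ready_done E i v k"
    by auto
  have gst: "gst E \<le> tm E ke"
    using gst_le_enter[OF k(2) assms] .
  obtain B kb where kb: "proposes E v B kb" "tm E kb \<le> tm E ke + delta E"
    using proposed_after_entry[OF assms k(2)] .
  have "clock E i (tm E k) = clock E i (tm E ke) + (tm E k - tm E ke)"
    by (rule clock_diff[OF i gst]) (use k(1) tm_mono in simp)
  hence late: "tm E ke + delta E + delta E + delta E < tm E k"
    using dl delta_le delta_pos unfolding at_deadline_def ready_limit_def by linarith
  have "\<exists>g cl. rcvd E i j (Echo v g B cl) k" if j: "j \<in> parties E" for j
  proof -
    have "cut (tm E ke + delta E) \<le> cut (tm E ke + delta E + delta E)"
      using cut_mono delta_pos by simp
    hence "entered E j v (cut (tm E ke + delta E + delta E))"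
      using entry_near[OF assms j k(2)] unfolding entered_def by (meson less_le_trans)
    then obtain k' cl where k': "ev E k' = Bcast j (Echo v G1 B cl)"
      "tm E k' \<le> tm E ke + delta E + delta E"
      using echo_by[OF assms kb j] by blast
    have "rcvd E i j (Echo v G1 B cl) (cut (tm E ke + delta E + delta E + delta E))"
      using rcvd_by[OF k' _ i] gst delta_pos by simp
    thus ?thesis
      using rcvd_mono[OF cut_le[OF late]] by blast
  qed
  hence "quorum E \<le> echo_count_any E i v B k"
    unfolding echo_count_any_def by (rule quorum_of_all)
  hence "ready_enabled E i v B k"
    using nd by (simp add: ready_enabled_def)
  thus False
    using dl unfolding at_deadline_def settled_def by blast
qed

lemma ready_full:
  assumes "r \<le> v" "ev E k = Bcast i m" "ready_resp v m"
  obtains B where "m = Ready v G1 B"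
proof (cases m)
  case (Ready u g B)
  hence m: "m = Ready v g B"
    using assms(3) by simp
  have "\<not> refine_allowed E i v g B k"
    using ready_not_mix[OF assms(1)] unfolding refine_allowed_def sent_def by blast
  hence "g = G1"
    using may_send[OF assms(2)] ready_enabled_count[OF assms(1)] m by auto
  thus thesis
    using m that by simp
next
  case (No_Ready u)
  thus thesis
    using no_no_ready[OF assms(1)] assms(2,3) by auto
qed (use assms(3) in auto)

text \<open>Grade-0 READYs do not occur from view \<open>r\<close> on, so no rule can produce
  \<open>Commit_Core\<close>, and the proposal of a view is unique. Whichever rule fires first, the
  seal is the same.\<close>

lemma sealed_full:
  assumes "r \<le> v" "sealed E R i v d k" "proposes E v (C, T) kb"
  shows "d = Commit_Full C T"
proof -
  obtain k0 where k0: "seal_condition E R i v d k0"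
    using assms(2) by (auto simp: sealed_def)
  have "quorum E \<le> ready_count E i v G0 (C', T') k0 \<Longrightarrow> False" for C' T'
  proof -
    assume "quorum E \<le> ready_count E i v G0 (C', T') k0"
    then obtain j where "rcvd E i j (Ready v G0 (C', T')) k0"
      using quorum_witness[of "\<lambda>j. rcvd E i j (Ready v G0 (C', T')) k0"]
      unfolding ready_count_def by blast
    then obtain k' where "ev E k' = Bcast j (Ready v G0 (C', T'))"
      using rcvd_sent unfolding sent_def by blast
    thus False
      using ready_full[OF assms(1)] by (metis grade.distinct(1) msg.inject(5) ready_resp.simps(1))
  qed
  hence "\<exists>C' T'. d = Commit_Full C' T'"
    using k0 unfolding seal_condition_def by blast
  thus ?thesis
    using seal_proposes[OF k0] proposes_unique(2)[OF assms(3)] by force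
qed

subsection \<open>Sealing and sequencing times\<close>

lemma beta_r: obtains B k where "proposes E r B k" "tm E k = beta E r" "gst E \<le> beta E r"
  using suffix beta_eq gst_le_proposal unfolding responsive_suffix_def by (metis order.refl)

lemma proposed_before_r: "1 \<le> u \<Longrightarrow> u \<le> r \<Longrightarrow> beta E r \<le> s \<Longrightarrow> proposed_by E u s"
proof (cases "u = r")
  case True
  assume "beta E r \<le> s"
  moreover obtain B k where "proposes E r B k" "tm E k = beta E r"
    using beta_r by blast
  ultimately show ?thesis
    using True unfolding proposed_by_def by fastforce
next
  case False
  assume "1 \<le> u" "u \<le> r" "beta E r \<le> s"
  hence "proposed_by E u (beta E r)"
    using suffix False by (auto simp: responsive_suffix_def)
  thus ?thesis
    using \<open>beta E r \<le> s\<close> unfolding proposed_by_def by (meson order.trans)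
qed

text \<open>All views up to \<open>v\<close> share the one bound \<open>s\<close> instead of being
  timed from their own sends. In-order output then costs nothing beyond sealing
  \<open>v\<close>.\<close>

lemma echo_spread:
  assumes "\<And>u. 1 \<le> u \<Longrightarrow> u \<le> v \<Longrightarrow> proposed_by E u s" "r \<le> u" "u \<le> v" "proposes E u B k"
    and "i \<in> parties E"
  obtains k' cl where "ev E k' = Bcast i (Echo u G1 B cl)" "tm E k' \<le> s + delta E"
proof -
  have k: "tm E k \<le> s"
    using assms(1)[of u] assms(3) proposed_by_iff[OF assms(4)] proposesD(1)[OF assms(4)] by simp
  hence "gst E \<le> s"
    using gst_le_proposal[OF assms(4,2)] by simp
  hence "u \<le> frontier E i (cut (s + delta E))"
    using frontier_by[OF _ assms(5) assms(1)] assms(3) by (meson order.trans)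
  thus thesis
    using echo_by[OF assms(2,4) k assms(5)] that by blast
qed

lemma ready_spread:
  assumes "\<And>u. 1 \<le> u \<Longrightarrow> u \<le> v \<Longrightarrow> proposed_by E u s" "r \<le> u" "u \<le> v" "proposes E u B k"
    and "i \<in> parties E"
  obtains k' where "ev E k' = Bcast i (Ready u G1 B)" "tm E k' \<le> s + 2 * delta E"
proof -
  let ?c = "cut (s + 2 * delta E)"
  have u: "1 \<le> u"
    using proposesD(1)[OF assms(4)] .
  have k: "tm E k \<le> s"
    using assms(1)[of u] assms(3) proposed_by_iff[OF assms(4)] u by simp
  hence gst: "gst E \<le> s"
    using gst_le_proposal[OF assms(4,2)] by simp
  have "\<exists>g cl. rcvd E i j (Echo u g B cl) ?c" if j: "j \<in> parties E" for j
  proof -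
    obtain k' cl where "ev E k' = Bcast j (Echo u G1 B cl)" "tm E k' \<le> s + delta E"
      using echo_spread[OF assms(1-4) j] by blast
    hence "rcvd E i j (Echo u G1 B cl) (cut (s + delta E + delta E))"
      using rcvd_by[OF _ _ _ assms(5)] gst delta_pos by (smt (verit))
    thus ?thesis
      by (auto simp: algebra_simps)
  qed
  hence "quorum E \<le> echo_count_any E i u B ?c"
    unfolding echo_count_any_def by (rule quorum_of_all)
  moreover have "k < ?c"
    using k delta_pos by (simp add: less_cut_iff)
  ultimately have "ready_done E i u ?c"
    using settled_cut(3)[OF assms(5), of "s + 2 * delta E"] unfolding ready_enabled_def
    by (metis gr_zeroI not_less0)
  then obtain k' m where k': "k' < ?c" "ev E k' = Bcast i m" "ready_resp u m"
    using u by (auto simp: ready_done_def sent_def)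
  then obtain B' where m: "m = Ready u G1 B'"
    using ready_full[OF assms(2)] by blast
  then obtain k'' where "proposes E u B' k''"
    using ready_proposes k'(2) by blast
  hence "B' = B"
    using proposes_unique(2)[OF assms(4)] by blast
  thus thesis
    using that k' m by (simp add: less_cut_iff)
qed

text \<open>Records which sealing rule is relied on, so that one argument serves the whole protocol
  (\<open>UNIV\<close>) and each sealing path alone.\<close>

definition seals_by :: "seal_rule set \<Rightarrow> real \<Rightarrow> real \<Rightarrow> bool" where
  "seals_by R s \<tau> \<longleftrightarrow>
     Fast_Seal \<in> R \<and> s + 2 * delta E \<le> \<tau> \<or> Ready_Path \<in> R \<and> s + 3 * delta E \<le> \<tau>"

lemma seal_spread:
  assumes "\<And>u. 1 \<le> u \<Longrightarrow> u \<le> v \<Longrightarrow> proposed_by E u s" "r \<le> u" "u \<le> v" "proposes E u (C, T) k"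
    and "i \<in> parties E" "seals_by R s \<tau>"
  shows "sealed E R i u (Commit_Full C T) (cut \<tau>)"
proof -
  have "gst E \<le> s"
    using assms(1)[of u] assms(3) proposed_by_iff[OF assms(4)] proposesD(1)[OF assms(4)]
      gst_le_proposal[OF assms(4,2)] by fastforce
  hence gst: "gst E \<le> s + delta E" "gst E \<le> s + 2 * delta E"
    using delta_pos by auto
  have "\<exists>cl. rcvd E i j (Echo u G1 (C, T) cl) (cut (s + 2 * delta E))" if j: "j \<in> parties E" for j
  proof -
    obtain k' cl where "ev E k' = Bcast j (Echo u G1 (C, T) cl)" "tm E k' \<le> s + delta E"
      using echo_spread[OF assms(1-4) j] by blast
    hence "rcvd E i j (Echo u G1 (C, T) cl) (cut (s + delta E + delta E))"
      using rcvd_by gst(1) assms(5) by blast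
    thus ?thesis
      by (auto simp: algebra_simps)
  qed
  hence fast: "\<forall>j\<in>parties E. \<exists>cl. rcvd E i j (Echo u G1 (C, T) cl) (cut \<tau>)" if "s + 2 * delta E \<le> \<tau>"
    using rcvd_mono[OF cut_mono[OF that]] by blast
  have "rcvd E i j (Ready u G1 (C, T)) (cut (s + 3 * delta E))" if j: "j \<in> parties E" for j
  proof -
    obtain k' where "ev E k' = Bcast j (Ready u G1 (C, T))" "tm E k' \<le> s + 2 * delta E"
      using ready_spread[OF assms(1-4) j] by blast
    hence "rcvd E i j (Ready u G1 (C, T)) (cut (s + 2 * delta E + delta E))"
      using rcvd_by gst(2) assms(5) by blast
    thus ?thesis
      by (auto simp: algebra_simps)
  qed
  hence "quorum E \<le> ready_count E i u G1 (C, T) (cut \<tau>)" if "s + 3 * delta E \<le> \<tau>"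
    unfolding ready_count_def by (intro quorum_of_all) (use rcvd_mono[OF cut_mono[OF that]] in blast)
  hence "seal_condition E R i u (Commit_Full C T) (cut \<tau>)"
    using fast assms(6) unfolding seals_by_def seal_condition_def by blast
  then obtain d where "sealed E R i u d (cut \<tau>)"
    using sealed_exists by blast
  thus ?thesis
    using sealed_full[OF assms(2) _ assms(4)] by blast
qed

text \<open>Views below \<open>r\<close> were output by \<open>beta E r\<close> by the assumption on
  the suffix; the views from \<open>r\<close> on are all sealed by the common bound.\<close>

lemma processed_by:
  assumes "\<And>u. 1 \<le> u \<Longrightarrow> u \<le> v \<Longrightarrow> proposed_by E u s" "beta E r \<le> s" "i \<in> parties E" "seals_by R s \<tau>"
  shows "processed E r R i v (cut \<tau>)"
  unfolding processed_def
proof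
  fix u assume u: "u \<in> {1..v}"
  \<comment> \<open>Sealing is granted at least two delays, whereas the named lanes arrive within
    one, so the demand of \<open>processed\<close> to hold them causes no delay.\<close>
  have \<tau>: "s + delta E \<le> \<tau>"
    using assms(4) delta_pos by (auto simp: seals_by_def)
  show "\<exists>d. sealed E (rules_from r R u) i u d (cut \<tau>) \<and> (\<forall>\<rho>\<in>named_refs d. holds E i \<rho> (cut \<tau>))"
  proof (cases "u < r")
    case True
    hence "by_time E (beta E r) (processed E r UNIV i u)"
      using suffix u assms(3) by (auto simp: responsive_suffix_def)
    hence "processed E r UNIV i u (cut (beta E r))"
      using by_time_iff[of "processed E r UNIV i u"] processed_mono by blast
    moreover have "cut (beta E r) \<le> cut \<tau>"
      using cut_mono assms(2) \<tau> delta_pos by simp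
    ultimately have "processed E r UNIV i u (cut \<tau>)"
      using processed_mono by blast
    thus ?thesis
      using True u by (auto simp: processed_def rules_from_def)
  next
    case False
    obtain C T k where B: "proposes E u (C, T) k" "tm E k \<le> s"
      using assms(1)[of u] u by (auto simp: proposed_by_def)
    have "sealed E R i u (Commit_Full C T) (cut \<tau>)"
      using seal_spread[OF assms(1) _ _ B(1) assms(3,4)] False u by auto
    moreover have "holds E i \<rho> (cut \<tau>)" if "\<rho> \<in> C \<union> T" for \<rho>
      using refs_direct_pub_by[OF B _ assms(3), of \<rho>] that direct_pub_mono[OF cut_mono[OF \<tau>]]
        gst_le_proposal[OF B(1)] B(2) False by (simp add: holds_iff_direct_pub)
    ultimately show ?thesis
      using False by (auto simp: rules_from_def)
  qed
qed

lemma prefix_extending_proposed: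
  assumes "prefix_extending E v" "1 \<le> u" "u \<le> v"
  shows "proposed_by E u (beta E v)"
proof (cases "u = v")
  case True
  thus ?thesis
    using assms(1) beta_eq unfolding prefix_extending_def proposed_by_def by fastforce
qed (use assms in \<open>auto simp: prefix_extending_def\<close>)

lemma beta_r_le:
  assumes "prefix_extending E v" "r \<le> v"
  shows "beta E r \<le> beta E v"
proof -
  obtain B k where "proposes E r B k" "tm E k = beta E r"
    using beta_r by blast
  thus ?thesis
    using prefix_extending_proposed[OF assms(1) _ assms(2)] proposed_by_iff proposesD(1) by metis
qed

lemma sequenced_after_proposal:
  assumes "prefix_extending E v" "r \<le> v" "proposes E v (C, T) k" "\<rho> \<in> cov (Commit_Full C T)"
    and "covers E \<rho> b" "seals_by R (tm E k) \<tau>"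
  shows "sequenced_by E r R cov b \<tau>"
  unfolding sequenced_by_def
proof (intro ballI by_time_cut)
  fix i assume i: "i \<in> parties E"
  have beta: "beta E v = tm E k"
    using assms(3) by (rule beta_eq)
  note proposed = prefix_extending_proposed[OF assms(1), unfolded beta]
  have "processed E r R i v (cut \<tau>)"
    using processed_by[OF proposed _ i assms(6)] beta_r_le[OF assms(1,2)] beta by simp
  moreover have "sealed E (rules_from r R v) i v (Commit_Full C T) (cut \<tau>)"
    using seal_spread[OF proposed assms(2) order.refl assms(3) i assms(6)] assms(2)
    by (simp add: rules_from_def)
  ultimately show "sequenced_at E r R cov i b (cut \<tau>)"
    using assms(4,5) proposesD(1)[OF assms(3)] unfolding sequenced_at_def by blast
qed

section \<open>Proposal opportunities\<close>

lemma prefix_extending_r: "prefix_extending E r"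
  using suffix by (auto simp: responsive_suffix_def prefix_extending_def)

lemma beta_r_opportunity: "beta E r \<in> opportunities E r"
  using prefix_extending_r by (auto simp: opportunities_def)

lemma opportunities_ge: "s \<in> opportunities E r \<Longrightarrow> beta E r \<le> s"
  using beta_r_le by (auto simp: opportunities_def)

lemma opportunityE:
  assumes "s \<in> opportunities E r"
  obtains v C T k where "r \<le> v" "prefix_extending E v" "proposes E v (C, T) k" "tm E k = s"
proof -
  obtain v where v: "r \<le> v" "prefix_extending E v" "s = beta E v"
    using assms by (auto simp: opportunities_def)
  then obtain B k where "proposes E v B k"
    by (auto simp: prefix_extending_def)
  thus thesis
    using that[of v "fst B" "snd B" k] v beta_eq by simp
qed

lemma finite_opportunities: "finite {s \<in> opportunities E r. s \<le> x}"
proof (rule finite_subset)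
  show "{s \<in> opportunities E r. s \<le> x} \<subseteq> tm E ` {..<cut x}"
    by (auto elim!: opportunityE simp: less_cut_iff)
qed simp

lemma finite_proposed: "finite {v. proposed_by E v s}"
proof (rule finite_subset)
  show "{v. proposed_by E v s} \<subseteq>
      (\<lambda>k. case ev E k of Bcast _ (Proposal v _) \<Rightarrow> v | _ \<Rightarrow> 0) ` {..<cut s}"
    by (force simp: proposed_by_def proposes_def less_cut_iff)
qed simp

text \<open>The least view not proposed by time \<open>\<tau>\<close> becomes proposable everywhere within \<open>\<delta>\<close>.\<close>

lemma opportunity_within_delta:
  assumes "beta E r \<le> \<tau>"
  shows "\<exists>s\<in>opportunities E r. \<tau> < s \<and> s \<le> \<tau> + delta E"
proof -
  let ?P = "\<lambda>v. 1 \<le> v \<and> \<not> proposed_by E v \<tau>"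
  obtain v0 where "v0 \<notin> insert 0 {v. proposed_by E v \<tau>}"
    using ex_new_if_finite[OF infinite_UNIV_nat] finite_proposed by (metis finite_insert)
  hence ex: "\<exists>v. ?P v"
    by (intro exI[of _ v0]) auto
  define v where "v = (LEAST v. ?P v)"
  have v: "1 \<le> v" "\<not> proposed_by E v \<tau>"
    unfolding v_def using LeastI_ex[OF ex] by auto
  have below: "proposed_by E u \<tau>" if "1 \<le> u" "u < v" for u
    using not_less_Least[of u ?P] that unfolding v_def by blast
  have rv: "r \<le> v"
    using proposed_before_r[OF v(1) _ assms] v(2) by (meson nat_le_linear)
  have "gst E \<le> \<tau>"
    using beta_r assms by (meson order.trans)
  hence "v - 1 \<le> frontier E (proposer E v) (cut (\<tau> + delta E))"
    using frontier_by[OF _ proposer_in_parties] below by simp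
  moreover have "0 < cut (\<tau> + delta E)"
  proof -
    obtain B k where "proposes E r B k" "tm E k = beta E r"
      using beta_r by blast
    hence "k < cut (\<tau> + delta E)"
      using assms delta_pos by (simp add: less_cut_iff)
    thus ?thesis
      by simp
  qed
  ultimately have "proposed_by E v (\<tau> + delta E)"
    using proposed_by_cut v(1) by blast
  then obtain B k where B: "proposes E v B k" "tm E k \<le> \<tau> + delta E"
    by (auto simp: proposed_by_def)
  have late: "\<tau> < tm E k"
    using v(2) proposed_by_iff[OF B(1)] by simp
  have "prefix_extending E v"
    unfolding prefix_extending_def
  proof (intro conjI ballI)
    fix u assume "u \<in> {1..<v}"
    thus "proposed_by E u (beta E v)"
      using below[of u] late beta_eq[OF B(1)] unfolding proposed_by_def
      by (metis atLeastLessThan_iff order.strict_implies_order order.trans)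
  next
    show "\<exists>B k. proposes E v B k"
      using B(1) by blast
  qed (rule v(1))
  hence "beta E v \<in> opportunities E r"
    using rv by (auto simp: opportunities_def)
  hence "tm E k \<in> opportunities E r"
    using beta_eq[OF B(1)] by simp
  thus ?thesis
    using late B(2) by blast
qed

text \<open>Opportunities are locally finite and one follows every time, so the infimum is attained.
  Before the suffix, \<open>beta E r\<close> itself is such an opportunity.\<close>

lemma next_opportunity:
  shows "next_opportunity E r \<tau> \<in> opportunities E r" "\<tau> < next_opportunity E r \<tau>"
    and "\<And>s. s \<in> opportunities E r \<Longrightarrow> \<tau> < s \<Longrightarrow> next_opportunity E r \<tau> \<le> s"
proof -
  obtain s0 where s0: "s0 \<in> opportunities E r" "\<tau> < s0"
    using opportunity_within_delta[of \<tau>] beta_r_opportunity by (meson not_le)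
  let ?S = "{s \<in> opportunities E r. \<tau> < s}" and ?F = "{s \<in> opportunities E r. \<tau> < s \<and> s \<le> s0}"
  have fin: "finite ?F"
    by (rule finite_subset[OF _ finite_opportunities[of s0]]) auto
  have min: "Min ?F \<in> ?F"
    using s0 by (intro Min_in fin) auto
  have le: "Min ?F \<le> s" if "s \<in> ?S" for s
  proof (cases "s \<le> s0")
    case True
    thus ?thesis
      using that by (intro Min_le fin) auto
  next
    case False
    thus ?thesis
      using min by auto
  qed
  have eq: "next_opportunity E r \<tau> = Min ?F"
    unfolding next_opportunity_def using min by (intro cInf_eq_minimum le) auto
  show "next_opportunity E r \<tau> \<in> opportunities E r" "\<tau> < next_opportunity E r \<tau>"
    "\<And>s. s \<in> opportunities E r \<Longrightarrow> \<tau> < s \<Longrightarrow> next_opportunity E r \<tau> \<le> s"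
    unfolding eq using min le by auto
qed

lemma next_opportunity_le: "beta E r \<le> \<tau> \<Longrightarrow> next_opportunity E r \<tau> \<le> \<tau> + delta E"
  using opportunity_within_delta[of \<tau>] next_opportunity(3)[of _ \<tau>] by fastforce

text \<open>All views below \<open>r\<close> were proposed by \<open>beta E r\<close>. This places
  the proposals of the aligned claims, which are given only by their send times, in the
  suffix.\<close>

lemma prefix_extending_ge_r:
  assumes "prefix_extending E v" "beta E r < beta E v"
  shows "r \<le> v"
proof (rule ccontr)
  assume "\<not> r \<le> v"
  hence "proposed_by E v (beta E r)"
    using proposed_before_r assms(1) by (auto simp: prefix_extending_def)
  moreover obtain B k where "proposes E v B k"
    using assms(1) by (auto simp: prefix_extending_def)
  ultimately show False
    using proposed_by_iff beta_eq assms(2) by fastforce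
qed

lemma opportunity_0: "opportunity E r 0 = beta E r"
  using beta_r_opportunity opportunities_ge by (auto intro: cInf_eq_minimum)

lemma opportunity_in: "opportunity E r j \<in> opportunities E r"
  by (cases j) (use next_opportunity(1) beta_r_opportunity opportunity_0 in auto)

lemma opportunity_strict_mono: "strict_mono (opportunity E r)"
  by (rule strict_monoI_Suc) (simp add: next_opportunity(2))

lemma opportunity_gap: "opportunity E r (Suc j) \<le> opportunity E r j + delta E"
  using next_opportunity_le opportunities_ge opportunity_in by simp

lemma opportunity_unbounded: "\<exists>j. \<tau> < opportunity E r j"
proof (rule ccontr)
  assume "\<nexists>j. \<tau> < opportunity E r j"
  hence "range (opportunity E r) \<subseteq> {s \<in> opportunities E r. s \<le> \<tau>}"
    using opportunity_in by (auto simp: not_less)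
  hence "finite (range (opportunity E r))"
    using finite_opportunities finite_subset by blast
  moreover have "inj (opportunity E r)"
    using opportunity_strict_mono by (rule strict_mono_imp_inj_on)
  ultimately show False
    using finite_imageD infinite_UNIV_nat by blast
qed

lemma opportunity_interval:
  assumes "beta E r \<le> \<tau>"
  obtains j where "opportunity E r j \<le> \<tau>" "\<tau> < opportunity E r (Suc j)"
proof -
  define m where "m = (LEAST j. \<tau> < opportunity E r j)"
  have m: "\<tau> < opportunity E r m"
    unfolding m_def using opportunity_unbounded by (rule LeastI_ex)
  have "m \<noteq> 0"
    using m assms opportunity_0 by (metis not_less)
  then obtain j where j: "m = Suc j"
    using not0_implies_Suc by blast
  hence "\<not> \<tau> < opportunity E r j"
    unfolding m_def using not_less_Least[of j "\<lambda>j. \<tau> < opportunity E r j"] by simp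
  thus thesis
    using that[of j] m j by simp
qed

lemma next_opportunity_in_interval:
  assumes "opportunity E r j \<le> \<tau>" "\<tau> < opportunity E r (Suc j)"
  shows "next_opportunity E r \<tau> = opportunity E r (Suc j)"
proof (rule antisym)
  show "next_opportunity E r \<tau> \<le> opportunity E r (Suc j)"
    using next_opportunity(3)[OF opportunity_in assms(2)] .
  show "opportunity E r (Suc j) \<le> next_opportunity E r \<tau>"
    using next_opportunity(1,2)[of \<tau>] next_opportunity(3)[of _ "opportunity E r j"] assms(1) by simp
qed

section \<open>Latencies\<close>

text \<open>The third claim says that the infimum is attained. The state does not change between
  events: a \<open>\<tau>\<close> in the set that lies before the first event after the infimum sees
  no further event.\<close>

lemma eligibility:
  assumes "ev E k0 = Bcast a (Publish b)" "beta E r \<le> tm E k0"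
  shows "tm E k0 \<le> eligibility E b" "eligibility E b \<le> tm E k0 + delta E"
    and "\<And>i. i \<in> parties E \<Longrightarrow> direct_pub E i (block_ref E b) (cut (eligibility E b))"
proof -
  let ?S = "{\<tau>. \<forall>i\<in>parties E. by_time E \<tau> (direct_pub E i (block_ref E b))}"
  have S: "\<tau> \<in> ?S \<longleftrightarrow> (\<forall>i\<in>parties E. direct_pub E i (block_ref E b) (cut \<tau>))" for \<tau>
    using by_time_iff[of "direct_pub E _ (block_ref E b)", OF direct_pub_mono] by simp
  have gst: "gst E \<le> tm E k0"
    using beta_r assms(2) by (meson order.trans)
  have upper: "tm E k0 + delta E \<in> ?S"
    unfolding S using block_direct_pub[OF assms(1) order.refl gst] by blast
  have lower: "tm E k0 \<le> \<tau>" if \<tau>: "\<tau> \<in> ?S" for \<tau>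
  proof -
    obtain i where "i \<in> parties E"
      using parties_nonempty by blast
    hence "direct_pub E i (block_ref E b) (cut \<tau>)"
      using \<tau> S by blast
    hence "k0 < cut \<tau>"
      using assms(1) by (rule direct_pub_block_sent)
    thus ?thesis
      by (simp add: less_cut_iff)
  qed
  have e: "eligibility E b = Inf ?S"
    by (simp add: eligibility_def)
  show "tm E k0 \<le> eligibility E b"
    unfolding e using upper lower by (intro cInf_greatest) auto
  show "eligibility E b \<le> tm E k0 + delta E"
    unfolding e using lower by (intro cInf_lower[OF upper] bdd_belowI[of _ "tm E k0"])
  fix i assume i: "i \<in> parties E"
  let ?c = "cut (eligibility E b)"
  have "Inf ?S < tm E ?c"
    using less_cut_iff[of ?c "eligibility E b"] e by simp
  then obtain \<tau> where \<tau>: "\<tau> \<in> ?S" "\<tau> < tm E ?c"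
    using cInf_lessD[of ?S "tm E ?c"] upper by blast
  hence "direct_pub E i (block_ref E b) (cut \<tau>)"
    using S i by blast
  thus "direct_pub E i (block_ref E b) ?c"
    using direct_pub_mono[OF cut_le[OF \<tau>(2)]] by blast
qed

text \<open>Strictness matters: a send at the eligibility time itself could precede the last receipt
  in the order of events.\<close>

lemma eligible_direct_pub:
  assumes "ev E k0 = Bcast a (Publish b)" "beta E r \<le> tm E k0" "i \<in> parties E"
    and "eligibility E b < tm E k"
  shows "direct_pub E i (block_ref E b) k"
  using eligibility(3)[OF assms(1-3)] direct_pub_mono[OF cut_le[OF assms(4)]] by blast

section \<open>Sequencing through a tip entry or a core entry\<close>

lemma sequenced_via_tip:
  assumes "ev E k0 = Bcast a (Publish b)" "prefix_extending E v" "proposes E v B k"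
    and "beta E r \<le> tm E k0" "tm E k0 < tm E k"
    and "direct_pub E (proposer E v) (block_ref E b) k" "coverable E (proposer E v) b k"
  shows "sequenced_by E r UNIV named_refs b (tm E k + 2 * delta E)"
proof -
  obtain \<rho> where \<rho>: "\<rho> \<in> fst B \<union> snd B" "covers E \<rho> b"
    using coverable_covers[OF assms(3,1,6,7)] by blast
  have "r \<le> v"
    using prefix_extending_ge_r[OF assms(2)] beta_eq[OF assms(3)] assms(4,5) by simp
  moreover have "proposes E v (fst B, snd B) k"
    using assms(3) by simp
  ultimately show ?thesis
    using sequenced_after_proposal[OF assms(2), of "fst B" "snd B" k \<rho> named_refs b UNIV] \<rho>
    by (simp add: seals_by_def)
qed

text \<open>The bound \<open>s\<close> stands in for the send time of the anchoring proposal: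
  \<open>beta E r \<le> s\<close> puts \<open>s\<close> after GST, so the view \<open>u\<close> may
  be arbitrary.\<close>

lemma sequenced_via_core:
  assumes "ev E k0 = Bcast a (Publish b)" "prefix_extending E w" "proposes E w B' k'"
    and "beta E r \<le> s" "tm E k' > s + delta E"
    and "proposes E u B k" "tm E k \<le> s" "\<rho> \<in> fst B \<union> snd B" "covers E \<rho> b"
    and "exact_available E (quorum E) (proposer E w) \<rho> k'" "seals_by R (tm E k') \<tau>"
  shows "sequenced_by E r R core_refs b \<tau>"
proof -
  have "gst E \<le> s"
    using beta_r assms(4) by (meson order.trans)
  hence "direct_pub E (proposer E w) \<rho> (cut (s + delta E))"
    using refs_direct_pub_by[OF assms(6,7) _ proposer_in_parties assms(8)] by blast
  hence "direct_pub E (proposer E w) \<rho> k'"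
    using direct_pub_mono[OF cut_le[OF assms(5)]] by blast
  then obtain \<kappa> where \<kappa>: "\<kappa> \<in> fst B'" "covers E \<kappa> b"
    using exact_available_covers[OF assms(3,1,9) _ assms(10)] by blast
  have "r \<le> w"
    using prefix_extending_ge_r[OF assms(2)] beta_eq[OF assms(3)] assms(4,5) delta_pos by simp
  moreover have "proposes E w (fst B', snd B') k'"
    using assms(3) by simp
  ultimately show ?thesis
    using sequenced_after_proposal[OF assms(2), of "fst B'" "snd B'" k' \<kappa> core_refs b R \<tau>] \<kappa> assms(11)
    by simp
qed

lemma tip_sequenced:
  assumes "ev E k0 = Bcast a (Publish b)" "beta E r \<le> tm E k0" "tip_eligible E r b"
  shows "sequenced_by E r UNIV named_refs b (next_opportunity E r (eligibility E b) + 2 * delta E)"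
proof -
  let ?s = "next_opportunity E r (eligibility E b)"
  obtain v C T k where B: "r \<le> v" "prefix_extending E v" "proposes E v (C, T) k" "tm E k = ?s"
    using opportunityE[OF next_opportunity(1)] by blast
  have late: "eligibility E b < tm E k"
    using next_opportunity(2) B(4) by simp
  have "coverable E (proposer E v) b k"
    using assms(3) B unfolding tip_eligible_def by blast
  moreover have "direct_pub E (proposer E v) (block_ref E b) k"
    using eligible_direct_pub[OF assms(1,2) proposer_in_parties late] .
  moreover have "tm E k0 < tm E k"
    using eligibility(1)[OF assms(1,2)] late by simp
  ultimately show ?thesis
    using sequenced_via_tip[OF assms(1) B(2,3) assms(2)] B(4) by simp
qed

text \<open>A core entry of the author anchors the tip, so every full ECHO comes with receipt of the whole
  lane; if the reference names \<open>b\<close> itself, eligibility already provides that.\<close>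

lemma exact_ack_quorum:
  assumes "ev E k0 = Bcast a (Publish b)" "beta E r \<le> tm E k0" "ack_eligible E r b"
    and "r \<le> v" "prefix_extending E v" "proposes E v (C, T) k"
    and "tm E k = next_opportunity E r (eligibility E b)" "\<rho> \<in> T" "covers E \<rho> b"
  shows "quorum E \<le> card {j \<in> parties E. \<exists>k' g cl.
    ev E k' = Bcast j (Echo v g (C, T) cl) \<and> (\<rho>, Exact) \<in> cl}"
proof (cases "height b < rheight \<rho> \<and> (\<forall>\<kappa>\<in>C. rauthor \<kappa> \<noteq> author b)")
  case True
  thus ?thesis
    using assms(3-9) unfolding ack_eligible_def by blast
next
  case False
  have beta: "beta E v = tm E k"
    using beta_eq[OF assms(6)] .
  have late: "eligibility E b < tm E k"
    using next_opportunity(2) assms(7) by simp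
  show ?thesis
  proof (rule quorum_of_all)
    fix j assume j: "j \<in> parties E"
    obtain k' cl where k': "ev E k' = Bcast j (Echo v G1 (C, T) cl)"
      using echo_spread[OF prefix_extending_proposed[OF assms(5)] assms(4) order.refl assms(6) j] by blast
    obtain k'' where "k'' < k'" "proposes E v (C, T) k''"
      using echo_fixed[OF k'] fixed_proposes by blast
    hence after: "k \<le> k'"
      using proposes_unique(1)[OF assms(6)] by simp
    have "direct_pub E j \<rho> k'"
    proof (cases "\<exists>\<kappa>\<in>C. rauthor \<kappa> = author b")
      case True
      obtain B cl' where B: "Echo v G1 (C, T) cl = Echo v G1 B cl'" "full_echo_enabled E j v B k'"
        using echo_full[OF assms(4) k'] by auto
      hence "B = (C, T)"
        by simp
      hence "tip_anchored E j C T k'"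
        using B(2) by (simp add: full_echo_enabled_def tip_ok_def)
      thus ?thesis
        using True assms(8) coversD(1)[OF assms(9)]
        by (auto simp: tip_anchored_def holds_iff_direct_pub)
    next
      case no_core: False
      hence "rheight \<rho> = height b"
        using False coversD(2)[OF assms(9)] by auto
      moreover have "direct_pub E (proposer E v) \<rho> k"
        using proposes_direct_pub[OF assms(6)] assms(8) by simp
      moreover have "rauthor (block_ref E b) = rauthor \<rho>" "rheight (block_ref E b) = height b"
        using coversD(1)[OF assms(9)] by (simp_all add: block_ref_def)
      ultimately have "block_ref E b = \<rho>"
        using direct_pub_eq[OF eligible_direct_pub[OF assms(1,2) j late]] by metis
      thus ?thesis
        using direct_pub_mono[OF after] eligible_direct_pub[OF assms(1,2) j late] by blast
    qed
    hence "(\<rho>, Exact) \<in> cl"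
      using echo_fixed[OF k'] assms(8) by (force simp: claims_def)
    thus "\<exists>k' g cl. ev E k' = Bcast j (Echo v g (C, T) cl) \<and> (\<rho>, Exact) \<in> cl"
      using k' by blast
  qed
qed

lemma sequenced_by_mono: "sequenced_by E r R cov b \<tau> \<Longrightarrow> \<tau> \<le> \<tau>' \<Longrightarrow> sequenced_by E r R cov b \<tau>'"
  unfolding sequenced_by_def by_time_def by (meson order.trans)

text \<open>If the first opportunity covers \<open>b\<close> by its core, two delays suffice.
  Otherwise its tip anchors \<open>b\<close>, and a later opportunity whose proposer has counted the
  acknowledgments places a covering reference in its core.\<close>

lemma core_sequenced:
  assumes "ev E k0 = Bcast a (Publish b)" "beta E r \<le> tm E k0"
    and "tip_eligible E r b" "ack_eligible E r b"
  shows "sequenced_by E r UNIV core_refs b (next_opportunity E r (eligibility E b) + 5 * delta E)"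
proof -
  define s where "s = next_opportunity E r (eligibility E b)"
  obtain v C T k where B: "r \<le> v" "prefix_extending E v" "proposes E v (C, T) k" "tm E k = s"
    using opportunityE[OF next_opportunity(1)] unfolding s_def by blast
  have late: "eligibility E b < tm E k"
    using next_opportunity(2) B(4) by (simp add: s_def)
  have "coverable E (proposer E v) b k"
    using assms(3) B unfolding tip_eligible_def s_def by blast
  then obtain \<rho> where \<rho>: "\<rho> \<in> C \<union> T" "covers E \<rho> b"
    using coverable_covers[OF B(3) assms(1) eligible_direct_pub[OF assms(1,2) proposer_in_parties late]]
    by auto
  have "beta E r \<le> s"
    using beta_r_le[OF B(2,1)] beta_eq[OF B(3)] B(4) by simp
  hence gst: "gst E \<le> s + delta E" "beta E r \<le> s"
    using beta_r delta_pos by (smt (verit))+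
  show ?thesis
  proof (cases "\<rho> \<in> C")
    case True
    have "sequenced_by E r UNIV core_refs b (s + 5 * delta E)"
      using sequenced_after_proposal[OF B(2,1,3) _ \<rho>(2), of core_refs UNIV] True B(4) delta_pos
      by (simp add: seals_by_def)
    thus ?thesis
      by (simp add: s_def)
  next
    case False
    hence tip: "\<rho> \<in> T"
      using \<rho>(1) by simp
    let ?ack = "\<lambda>j. \<exists>k' g cl. ev E k' = Bcast j (Echo v g (C, T) cl) \<and> (\<rho>, Exact) \<in> cl"
    have quorum: "quorum E \<le> card {j \<in> parties E. ?ack j}"
      using exact_ack_quorum[OF assms(1,2,4) B(1-3) _ tip \<rho>(2)] B(4) s_def by simp
    \<comment> \<open>By \<open>s + 2 * delta E\<close> the ECHOs of the anchoring proposal have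
      reached every party. Only an opportunity strictly after that time is certain to be sent with
      all of them counted.\<close>
    obtain w C' T' k' where B': "r \<le> w" "prefix_extending E w" "proposes E w (C', T') k'"
      "tm E k' = next_opportunity E r (s + 2 * delta E)"
      using opportunityE[OF next_opportunity(1)] by blast
    have late': "s + 2 * delta E < tm E k'" "tm E k' \<le> s + 3 * delta E"
      using next_opportunity(2)[of "s + 2 * delta E"] next_opportunity_le[of "s + 2 * delta E"] B'(4)
        gst(2) delta_pos by auto
    have "exact_ack E (proposer E w) j \<rho> k'" if j: "j \<in> parties E" "?ack j" for j
    proof -
      obtain l g cl where l: "ev E l = Bcast j (Echo v g (C, T) cl)" "(\<rho>, Exact) \<in> cl"
        using j(2) by blast
      obtain l' cl' where l': "ev E l' = Bcast j (Echo v G1 (C, T) cl')" "tm E l' \<le> s + delta E"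
        using echo_spread[OF prefix_extending_proposed[OF B(2)] B(1) order.refl B(3) j(1)]
          beta_eq[OF B(3)] B(4) by auto
      \<comment> \<open>The quorum only asserts that a suitable ECHO exists, at no stated time. A
        party has one echo-stage response per view, so it is the one known to be sent by
        \<open>s + delta E\<close>.\<close>
      have "l = l'"
        using echo_unique[OF l(1) l'(1), of v] by simp
      hence "rcvd E (proposer E w) j (Echo v g (C, T) cl) (cut (s + delta E + delta E))"
        using rcvd_by[OF l(1) _ gst(1) proposer_in_parties] l'(2) by blast
      moreover have "cut (s + delta E + delta E) \<le> k'"
        using late'(1) by (intro cut_le) simp
      ultimately show ?thesis
        using l(2) rcvd_mono unfolding exact_ack_def by blast
    qed
    hence "card {j \<in> parties E. ?ack j} \<le> card {j \<in> parties E. exact_ack E (proposer E w) j \<rho> k'}"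
      by (intro card_mono) (auto simp: finite_parties)
    hence "exact_available E (quorum E) (proposer E w) \<rho> k'"
      using quorum by (simp add: exact_available_def)
    moreover have "s + delta E < tm E k'"
      using late'(1) delta_pos by simp
    ultimately have "sequenced_by E r UNIV core_refs b (tm E k' + 2 * delta E)"
      using sequenced_via_core[OF assms(1) B'(2,3) gst(2) _ B(3) _ _ \<rho>(2)] B(4) \<rho>(1)
      by (simp add: seals_by_def)
    thus ?thesis
      using sequenced_by_mono late'(2) by (simp add: s_def)
  qed
qed

section \<open>Latencies as infima of sequencing times\<close>

lemma sequenced_after_arrival:
  assumes "ev E k0 = Bcast a (Publish b)" "\<And>d. cov d \<subseteq> named_refs d"
    and "sequenced_by E r R cov b \<tau>"
  shows "tm E k0 \<le> \<tau>"
proof -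
  obtain i where "i \<in> parties E"
    using parties_nonempty by blast
  then obtain k where k: "\<forall>k'<k. tm E k' \<le> \<tau>" "sequenced_at E r R cov i b k"
    using assms(3) unfolding sequenced_by_def by_time_def by blast
  thus ?thesis
    using sequenced_after_publish[OF k(2) assms(2,1)] by blast
qed

text \<open>A real \<open>Inf\<close> is informative only for a nonempty set that is bounded below:
  the given bound makes it nonempty, causality bounds it by the arrival.\<close>

lemma Inf_sequenced:
  assumes "ev E k0 = Bcast a (Publish b)" "\<And>d. cov d \<subseteq> named_refs d"
    and "sequenced_by E r R cov b \<tau>"
  shows "tm E k0 \<le> Inf {\<tau>. sequenced_by E r R cov b \<tau>}" "Inf {\<tau>. sequenced_by E r R cov b \<tau>} \<le> \<tau>"
proof -
  note lower = sequenced_after_arrival[OF assms(1,2)]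
  show "tm E k0 \<le> Inf {\<tau>. sequenced_by E r R cov b \<tau>}"
    using assms(3) lower by (intro cInf_greatest) auto
  show "Inf {\<tau>. sequenced_by E r R cov b \<tau>} \<le> \<tau>"
    using assms(3) lower by (intro cInf_lower bdd_belowI[of _ "tm E k0"]) auto
qed

lemma core_refs_subset: "core_refs d \<subseteq> named_refs d"
  by (cases d) auto

lemma placesE:
  assumes "places E a tx b t"
  obtains k0 where "ev E k0 = Bcast a (Publish b)" "tm E k0 = t"
  using assms by (auto simp: places_def)

lemma L_tip_bounds:
  assumes "places E a tx b t" "beta E r \<le> t" "tip_eligible E r b"
  shows "0 \<le> L_tip E r b t" "L_tip E r b t \<le> next_opportunity E r (eligibility E b) + 2 * delta E - t"
proof -
  obtain k0 where k0: "ev E k0 = Bcast a (Publish b)" "tm E k0 = t"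
    using assms(1) by (rule placesE)
  note seq = tip_sequenced[OF k0(1) _ assms(3)]
  show "0 \<le> L_tip E r b t" "L_tip E r b t \<le> next_opportunity E r (eligibility E b) + 2 * delta E - t"
    using Inf_sequenced[OF k0(1) order.refl seq] assms(2) k0(2) by (auto simp: L_tip_def)
qed

lemma L_core_bounds:
  assumes "places E a tx b t" "beta E r \<le> t" "tip_eligible E r b" "ack_eligible E r b"
  shows "0 \<le> L_core E r b t" "L_core E r b t \<le> next_opportunity E r (eligibility E b) + 5 * delta E - t"
proof -
  obtain k0 where k0: "ev E k0 = Bcast a (Publish b)" "tm E k0 = t"
    using assms(1) by (rule placesE)
  note seq = core_sequenced[OF k0(1) _ assms(3,4)]
  show "0 \<le> L_core E r b t"
    "L_core E r b t \<le> next_opportunity E r (eligibility E b) + 5 * delta E - t"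
    using Inf_sequenced[OF k0(1) core_refs_subset seq] assms(2) k0(2) by (auto simp: L_core_def)
qed

lemma eligibility_bounds:
  assumes "places E a tx b t" "beta E r \<le> t"
  shows "t \<le> eligibility E b" "eligibility E b \<le> t + delta E"
    "next_opportunity E r (eligibility E b) \<le> t + 2 * delta E"
proof -
  obtain k0 where k0: "ev E k0 = Bcast a (Publish b)" "tm E k0 = t"
    using assms(1) by (rule placesE)
  show "t \<le> eligibility E b" "eligibility E b \<le> t + delta E"
    using eligibility(1,2)[OF k0(1)] k0(2) assms(2) by auto
  thus "next_opportunity E r (eligibility E b) \<le> t + 2 * delta E"
    using next_opportunity_le[of "eligibility E b"] assms(2) by simp
qed

section \<open>Expected latencies\<close>

text \<open>Expresses the next opportunity by the sequence \<open>opportunity E r\<close> alone,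
  which is what executions with a shared schedule have in common.\<close>

lemma next_opportunity_Least:
  assumes "beta E r \<le> \<tau>"
  shows "next_opportunity E r \<tau> = opportunity E r (LEAST j. \<tau> < opportunity E r j)"
proof -
  obtain j where j: "opportunity E r j \<le> \<tau>" "\<tau> < opportunity E r (Suc j)"
    using opportunity_interval[OF assms] .
  have "(LEAST j. \<tau> < opportunity E r j) = Suc j"
  proof (rule Least_equality)
    show "\<tau> < opportunity E r (Suc j)"
      using j(2) .
    fix i assume "\<tau> < opportunity E r i"
    hence "opportunity E r j < opportunity E r i"
      using j(1) by simp
    thus "Suc j \<le> i"
      using strict_mono_less[OF opportunity_strict_mono] by simp
  qed
  thus ?thesis
    using next_opportunity_in_interval[OF j] by simp
qed

lemma next_opportunity_measurable: "next_opportunity E r \<in> borel_measurable borel"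
proof (rule borel_measurable_mono, rule monoI)
  fix x y :: real assume "x \<le> y"
  thus "next_opportunity E r x \<le> next_opportunity E r y"
    using next_opportunity(1,2)[of y] next_opportunity(3)[of _ x] by simp
qed

text \<open>The integral is at most half the squared length. One factor is bounded by
  \<open>delta E\<close>, the other is kept as a measure, so that the estimate adds up over
  intervals and normalises directly.\<close>

lemma nn_integral_wait:
  "(\<integral>\<^sup>+x. ennreal (opportunity E r (Suc j) - x) *
      indicator {opportunity E r j ..< opportunity E r (Suc j)} x \<partial>lborel)
    \<le> ennreal (delta E / 2) * emeasure lborel {opportunity E r j ..< opportunity E r (Suc j)}"
proof -
  define p q where "p = opportunity E r j" and "q = opportunity E r (Suc j)"
  have pq: "p < q" "q \<le> p + delta E"
    unfolding p_def q_def using opportunity_strict_mono opportunity_gap[of j]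
    by (simp_all add: strict_mono_less del: opportunity.simps)
  have "(\<integral>\<^sup>+x. ennreal (q - x) * indicator {p..<q} x \<partial>lborel)
      \<le> (\<integral>\<^sup>+x. ennreal (q - x) * indicator {p..q} x \<partial>lborel)"
    by (intro nn_integral_mono mult_left_mono) (auto simp: indicator_def)
  also have "\<dots> = ennreal (- (q - q)\<^sup>2 / 2 - (- (q - p)\<^sup>2 / 2))"
    by (rule nn_integral_FTC_Icc[where F = "\<lambda>x. - (q - x)\<^sup>2 / 2"])
      (use pq in \<open>auto intro!: derivative_eq_intros simp: field_simps\<close>)
  also have "\<dots> \<le> ennreal (delta E / 2 * (q - p))"
  proof (rule ennreal_leI)
    have "(q - p) * (q - p) \<le> delta E * (q - p)"
      using pq by (intro mult_right_mono) auto
    thus "- (q - q)\<^sup>2 / 2 - (- (q - p)\<^sup>2 / 2) \<le> delta E / 2 * (q - p)"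
      by (simp add: power2_eq_square)
  qed
  also have "\<dots> = ennreal (delta E / 2) * emeasure lborel {p..<q}"
    using pq delta_pos ennreal_mult[of "delta E / 2" "q - p"] by simp
  finally show ?thesis
    by (simp add: p_def q_def)
qed

lemma nn_integral_wait_uniform:
  assumes "finite J" "J \<noteq> {}"
  shows "(\<integral>\<^sup>+x. ennreal (next_opportunity E r x - x)
      \<partial>uniform_measure lborel (opportunity_intervals E r J)) \<le> ennreal (delta E / 2)"
proof -
  define I where "I = (\<lambda>j. {opportunity E r j ..< opportunity E r (Suc j)})"
  have A: "opportunity_intervals E r J = (\<Union>j\<in>J. I j)"
    by (simp add: opportunity_intervals_def I_def)
  have sets: "(\<Union>j\<in>J. I j) \<in> sets lborel"
    using assms(1) by (auto simp: I_def)
  have [measurable]: "next_opportunity E r \<in> borel_measurable borel"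
    by (rule next_opportunity_measurable)
  have disjoint: "disjoint_family_on I J"
    unfolding disjoint_family_on_def
  proof (intro ballI impI)
    have "I i \<inter> I j = {}" if "i < j" for i j
    proof -
      have "opportunity E r (Suc i) \<le> opportunity E r j"
        using that strict_mono_less_eq[OF opportunity_strict_mono]
        by (simp add: Suc_le_eq del: opportunity.simps)
      thus ?thesis
        by (auto simp: I_def simp del: opportunity.simps)
    qed
    thus "I i \<inter> I j = {}" if "i \<noteq> j" for i j
      using that by (metis inf_commute nat_neq_iff)
  qed
  have measure: "emeasure lborel (\<Union>j\<in>J. I j) = (\<Sum>j\<in>J. emeasure lborel (I j))"
    by (rule sum_emeasure[symmetric]) (use assms(1) disjoint in \<open>auto simp: I_def\<close>)
  \<comment> \<open>Bounding by a sum over all of \<open>J\<close> avoids a piecewise formula: at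
    \<open>x\<close> the summand of the interval containing \<open>x\<close> already
    suffices.\<close>
  have pointwise: "ennreal (next_opportunity E r x - x) * indicator (\<Union>j\<in>J. I j) x
      \<le> (\<Sum>j\<in>J. ennreal (opportunity E r (Suc j) - x) * indicator (I j) x)" for x
  proof (cases "x \<in> (\<Union>j\<in>J. I j)")
    case True
    then obtain j where j: "j \<in> J" "x \<in> I j"
      by blast
    hence "next_opportunity E r x = opportunity E r (Suc j)"
      by (intro next_opportunity_in_interval) (auto simp: I_def)
    hence "ennreal (next_opportunity E r x - x) * indicator (\<Union>j\<in>J. I j) x =
        ennreal (opportunity E r (Suc j) - x) * indicator (I j) x"
      using True j by (simp del: opportunity.simps)
    also have "\<dots> \<le> (\<Sum>j\<in>J. ennreal (opportunity E r (Suc j) - x) * indicator (I j) x)"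
      by (rule member_le_sum) (use j assms(1) in auto)
    finally show ?thesis .
  qed simp
  have "(\<integral>\<^sup>+x. ennreal (next_opportunity E r x - x) * indicator (\<Union>j\<in>J. I j) x \<partial>lborel)
      \<le> (\<integral>\<^sup>+x. (\<Sum>j\<in>J. ennreal (opportunity E r (Suc j) - x) * indicator (I j) x) \<partial>lborel)"
    by (intro nn_integral_mono pointwise)
  also have "\<dots> = (\<Sum>j\<in>J. \<integral>\<^sup>+x. ennreal (opportunity E r (Suc j) - x) * indicator (I j) x \<partial>lborel)"
    by (intro nn_integral_sum) (simp add: I_def del: opportunity.simps)
  also have "\<dots> \<le> (\<Sum>j\<in>J. ennreal (delta E / 2) * emeasure lborel (I j))"
    unfolding I_def by (intro sum_mono nn_integral_wait)
  also have "\<dots> = ennreal (delta E / 2) * emeasure lborel (\<Union>j\<in>J. I j)"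
    by (simp add: measure sum_distrib_left)
  finally have bound: "(\<integral>\<^sup>+x. ennreal (next_opportunity E r x - x) * indicator (\<Union>j\<in>J. I j) x \<partial>lborel)
      \<le> ennreal (delta E / 2) * emeasure lborel (\<Union>j\<in>J. I j)" .
  \<comment> \<open>One interval of positive length makes the normalising measure positive, as the
    division below requires.\<close>
  obtain j where "j \<in> J"
    using assms(2) by blast
  hence "emeasure lborel (I j) \<le> emeasure lborel (\<Union>j\<in>J. I j)"
    using sets by (intro emeasure_mono) auto
  moreover have "0 < emeasure lborel (I j)"
    using strict_monoD[OF opportunity_strict_mono, of j "Suc j"]
    by (simp add: I_def del: opportunity.simps)
  ultimately have "0 < emeasure lborel (\<Union>j\<in>J. I j)"
    by order
  thus ?thesis
    unfolding A using bound sets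
    by (subst nn_integral_uniform_measure) (auto intro!: divide_le_posI_ennreal simp: mult.commute)
qed

text \<open>The nonnegative integral is bounded first because its finiteness gives integrability;
  the Bochner integral of a non-integrable function would be 0 by default.\<close>

lemma expected_wait:
  fixes M :: "'w measure" and e :: "'w \<Rightarrow> real"
  assumes "finite J" "J \<noteq> {}" "e \<in> borel_measurable M"
    and "distr M borel e = uniform_measure lborel (opportunity_intervals E r J)"
  shows "integrable M (\<lambda>\<omega>. next_opportunity E r (e \<omega>) - e \<omega>)"
    and "(\<integral>\<omega>. next_opportunity E r (e \<omega>) - e \<omega> \<partial>M) \<le> delta E / 2"
proof -
  note [measurable] = assms(3) next_opportunity_measurable
  have nonneg: "0 \<le> next_opportunity E r x - x" for x
    using next_opportunity(2)[of x] by simp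
  have "(\<integral>\<^sup>+\<omega>. ennreal (next_opportunity E r (e \<omega>) - e \<omega>) \<partial>M) =
      (\<integral>\<^sup>+x. ennreal (next_opportunity E r x - x) \<partial>distr M borel e)"
    by (simp add: nn_integral_distr)
  also have "\<dots> \<le> ennreal (delta E / 2)"
    unfolding assms(4) using nn_integral_wait_uniform assms(1,2) by blast
  finally have le: "(\<integral>\<^sup>+\<omega>. ennreal (next_opportunity E r (e \<omega>) - e \<omega>) \<partial>M) \<le> ennreal (delta E / 2)" .
  show int: "integrable M (\<lambda>\<omega>. next_opportunity E r (e \<omega>) - e \<omega>)"
    by (rule integrableI_nonneg) (use nonneg le in \<open>auto simp: le_less_trans[OF le]\<close>)
  show "(\<integral>\<omega>. next_opportunity E r (e \<omega>) - e \<omega> \<partial>M) \<le> delta E / 2"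
    using le nn_integral_eq_integral[OF int] nonneg delta_pos by simp
qed

text \<open>The execution may vary with the transaction, while the wait \<open>w\<close> is measured
  in the schedule of \<open>E\<close>. The two schedules agree from \<open>beta E r\<close> on, and
  eligibility is not earlier. The remaining constants are one delay for publication plus two or five
  after the opportunity.\<close>

lemma latency_of_shared_schedule:
  assumes "responsive_suffix E' r" "delta E' = delta E" "\<And>j. opportunity E' r j = opportunity E r j"
    and "places E' a tx b t" "beta E' r \<le> t" "tip_eligible E' r b"
  defines "w \<equiv> next_opportunity E r (eligibility E' b) - eligibility E' b"
  shows "0 \<le> L_tip E' r b t" "L_tip E' r b t \<le> w + 3 * delta E"
    and "ack_eligible E' r b \<Longrightarrow> 0 \<le> L_core E' r b t"
    and "ack_eligible E' r b \<Longrightarrow> L_core E' r b t \<le> w + 6 * delta E"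
proof -
  interpret E': responsive_run E' r
    by unfold_locales (rule assms(1))
  note e = E'.eligibility_bounds[OF assms(4,5)]
  have "beta E r = beta E' r"
    using opportunity_0 E'.opportunity_0 assms(3) by metis
  hence "next_opportunity E r (eligibility E' b) = next_opportunity E' r (eligibility E' b)"
    using next_opportunity_Least[of "eligibility E' b"] E'.next_opportunity_Least[of "eligibility E' b"]
      assms(3,5) e(1) by simp
  moreover note E'.L_tip_bounds[OF assms(4-6)] E'.L_core_bounds[OF assms(4-6)] e(2)
  ultimately show "0 \<le> L_tip E' r b t" "L_tip E' r b t \<le> w + 3 * delta E"
    "ack_eligible E' r b \<Longrightarrow> 0 \<le> L_core E' r b t"
    "ack_eligible E' r b \<Longrightarrow> L_core E' r b t \<le> w + 6 * delta E"
    unfolding w_def using assms(2) by auto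
qed

section \<open>Aligned and worst-case schedules\<close>

lemma ack_quorum_exact_available:
  "ack_quorum E i u B \<rho> k \<Longrightarrow> exact_available E (quorum E) i \<rho> k"
proof -
  have "{j \<in> parties E. \<exists>g cl. rcvd E i j (Echo u g B cl) k \<and> (\<rho>, Exact) \<in> cl}
      \<subseteq> {j \<in> parties E. exact_ack E i j \<rho> k}"
    unfolding exact_ack_def by blast
  hence "card {j \<in> parties E. \<exists>g cl. rcvd E i j (Echo u g B cl) k \<and> (\<rho>, Exact) \<in> cl}
      \<le> card {j \<in> parties E. exact_ack E i j \<rho> k}"
    by (intro card_mono) (simp_all add: finite_parties)
  thus "ack_quorum E i u B \<rho> k \<Longrightarrow> exact_available E (quorum E) i \<rho> k"
    by (simp add: ack_quorum_def exact_available_def)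
qed

lemma aligned_tip:
  assumes "places E a tx b t" "beta E r \<le> t" "prefix_extending E v" "proposes E v B k"
    and "tm E k = t + delta E" "direct_pub E (proposer E v) (block_ref E b) k"
    and "coverable E (proposer E v) b k"
  shows "sequenced_by E r UNIV named_refs b (t + 3 * delta E)"
proof -
  obtain k0 where k0: "ev E k0 = Bcast a (Publish b)" "tm E k0 = t"
    using assms(1) by (rule placesE)
  have "sequenced_by E r UNIV named_refs b (tm E k + 2 * delta E)"
    by (rule sequenced_via_tip[OF k0(1) assms(3,4) _ _ assms(6,7)])
      (use assms(2,5) k0(2) delta_pos in auto)
  moreover have "tm E k + 2 * delta E = t + 3 * delta E"
    using assms(5) by simp
  ultimately show ?thesis
    by simp
qed

lemma aligned_core:
  assumes "places E a tx b t" "beta E r \<le> t" "proposes E u B k" "tm E k = t + delta E"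
    and "\<rho> \<in> snd B" "covers E \<rho> b" "prefix_extending E w" "proposes E w B' k'"
    and "tm E k' = t + 3 * delta E" "ack_quorum E (proposer E w) u B \<rho> k'"
    and "seals_by R (t + 3 * delta E) \<tau>"
  shows "sequenced_by E r R core_refs b \<tau>"
proof -
  obtain k0 where k0: "ev E k0 = Bcast a (Publish b)" "tm E k0 = t"
    using assms(1) by (rule placesE)
  show ?thesis
    by (rule sequenced_via_core[OF k0(1) assms(7,8) _ _ assms(3) _ _ assms(6)
          ack_quorum_exact_available[OF assms(10)], of "t + delta E"])
      (use assms(2,4,5,9,11) delta_pos in auto)
qed

lemma worst_case_tip:
  assumes "places E a tx b t" "beta E r \<le> t" "tip_eligible E r b"
  shows "sequenced_by E r UNIV named_refs b (t + 4 * delta E)" "L_tip E r b t \<le> 4 * delta E"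
proof -
  obtain k0 where k0: "ev E k0 = Bcast a (Publish b)" "tm E k0 = t"
    using assms(1) by (rule placesE)
  note e = eligibility_bounds(3)[OF assms(1,2)]
  have "sequenced_by E r UNIV named_refs b (next_opportunity E r (eligibility E b) + 2 * delta E)"
    using tip_sequenced[OF k0(1) _ assms(3)] k0(2) assms(2) by simp
  thus "sequenced_by E r UNIV named_refs b (t + 4 * delta E)"
    by (rule sequenced_by_mono) (use e in simp)
  show "L_tip E r b t \<le> 4 * delta E"
    using L_tip_bounds(2)[OF assms] e by simp
qed

lemma worst_case_core:
  assumes "places E a tx b t" "beta E r \<le> t" "tip_eligible E r b" "ack_eligible E r b"
  shows "sequenced_by E r UNIV core_refs b (t + 7 * delta E)" "L_core E r b t \<le> 7 * delta E"
proof -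
  obtain k0 where k0: "ev E k0 = Bcast a (Publish b)" "tm E k0 = t"
    using assms(1) by (rule placesE)
  note e = eligibility_bounds(3)[OF assms(1,2)]
  have "sequenced_by E r UNIV core_refs b (next_opportunity E r (eligibility E b) + 5 * delta E)"
    using core_sequenced[OF k0(1) _ assms(3,4)] k0(2) assms(2) by simp
  thus "sequenced_by E r UNIV core_refs b (t + 7 * delta E)"
    by (rule sequenced_by_mono) (use e in simp)
  show "L_core E r b t \<le> 7 * delta E"
    using L_core_bounds(2)[OF assms] e by simp
qed

end

section \<open>Averaging over random executions\<close>

text \<open>A latency is known only to lie between 0 and the wait plus a constant. Domination turns
  its measurability into integrability, and total mass one keeps the constant unchanged.\<close>

lemma (in prob_space) expectation_le_shift:
  fixes f g :: "'a \<Rightarrow> real"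
  assumes [measurable]: "f \<in> borel_measurable M" and "integrable M g" "expectation g \<le> c"
    and "\<And>\<omega>. \<omega> \<in> space M \<Longrightarrow> 0 \<le> f \<omega> \<and> f \<omega> \<le> g \<omega> + d"
  shows "integrable M f" "expectation f \<le> c + d"
proof -
  have int: "integrable M (\<lambda>\<omega>. g \<omega> + d)"
    using assms(2) by simp
  show f: "integrable M f"
    by (rule Bochner_Integration.integrable_bound[OF int]) (use assms(4) in \<open>force intro!: AE_I2\<close>)+
  have "expectation f \<le> expectation (\<lambda>\<omega>. g \<omega> + d)"
    by (rule integral_mono[OF f int]) (use assms(4) in blast)
  also have "\<dots> = expectation g + d"
    using assms(2) by (simp add: prob_space)
  finally show "expectation f \<le> c + d"
    using assms(3) by simp
qed

theorem corollaryB9: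
  fixes E :: "('tx, 'h) execution" and r :: nat
    and M :: "'w measure" and X :: "'w \<Rightarrow> ('tx, 'h) execution"
    and a :: "'w \<Rightarrow> nat" and tx :: "'w \<Rightarrow> 'tx" and b :: "'w \<Rightarrow> ('tx, 'h) block"
    and t :: "'w \<Rightarrow> real" and e :: "'w \<Rightarrow> real"
  assumes suffix: "responsive_suffix E r"
  shows
    \<comment> \<open>worst-case and aligned latencies\<close>
    "(\<forall>a tx b t. places E a tx b t \<and> beta E r \<le> t \<longrightarrow>
        (tip_eligible E r b \<longrightarrow>
           sequenced_by E r UNIV named_refs b (t + 4 * delta E) \<and>
           L_tip E r b t \<le> delta E + delta E + 2 * delta E) \<and>
        (tip_eligible E r b \<and> ack_eligible E r b \<longrightarrow>
           sequenced_by E r UNIV core_refs b (t + 7 * delta E) \<and>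
           L_core E r b t \<le> delta E + delta E + 2 * delta E + delta E + 2 * delta E) \<and>
        (\<forall>v B k. prefix_extending E v \<and> proposes E v B k \<and> tm E k = t + delta E \<and>
           direct_pub E (proposer E v) (block_ref E b) k \<and> coverable E (proposer E v) b k \<longrightarrow>
           sequenced_by E r UNIV named_refs b (t + 3 * delta E)) \<and>
        (\<forall>u B k \<rho> w B' k'. proposes E u B k \<and> tm E k = t + delta E \<and>
           direct_pub E (proposer E u) (block_ref E b) k \<and> \<rho> \<in> snd B \<and> covers E \<rho> b \<and>
           prefix_extending E w \<and> proposes E w B' k' \<and> tm E k' = t + 3 * delta E \<and>
           ack_quorum E (proposer E w) u B \<rho> k' \<longrightarrow>
           sequenced_by E r UNIV core_refs b (t + 5 * delta E) \<and>
           sequenced_by E r {Fast_Seal} core_refs b (t + 5 * delta E) \<and>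
           sequenced_by E r {Ready_Path} core_refs b (t + 6 * delta E)))
    \<and>
    \<comment> \<open>expected wait of a uniform eligibility time, for the fixed proposal schedule of E\<close>
     (\<forall>J. finite J \<and> J \<noteq> {} \<and> prob_space M \<and> e \<in> borel_measurable M \<and>
        distr M borel e = uniform_measure lborel (opportunity_intervals E r J) \<longrightarrow>
        integrable M (\<lambda>\<omega>. next_opportunity E r (e \<omega>) - e \<omega>) \<and>
        (\<integral>\<omega>. next_opportunity E r (e \<omega>) - e \<omega> \<partial>M) \<le> delta E / 2)
    \<and>
    \<comment> \<open>expected latencies of a random transaction, in executions that share this schedule\<close>
     (\<forall>J. finite J \<and> J \<noteq> {} \<and> prob_space M \<and> e \<in> borel_measurable M \<and>
        distr M borel e = uniform_measure lborel (opportunity_intervals E r J) \<and>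
        (\<forall>\<omega>\<in>space M. responsive_suffix (X \<omega>) r \<and> delta (X \<omega>) = delta E \<and>
           (\<forall>j. opportunity (X \<omega>) r j = opportunity E r j) \<and>
           places (X \<omega>) (a \<omega>) (tx \<omega>) (b \<omega>) (t \<omega>) \<and> beta (X \<omega>) r \<le> t \<omega> \<and>
           e \<omega> = eligibility (X \<omega>) (b \<omega>) \<and> tip_eligible (X \<omega>) r (b \<omega>)) \<longrightarrow>
        ((\<lambda>\<omega>. L_tip (X \<omega>) r (b \<omega>) (t \<omega>)) \<in> borel_measurable M \<longrightarrow>
           integrable M (\<lambda>\<omega>. L_tip (X \<omega>) r (b \<omega>) (t \<omega>)) \<and>
           (\<integral>\<omega>. L_tip (X \<omega>) r (b \<omega>) (t \<omega>) \<partial>M) \<le> delta E + delta E / 2 + 2 * delta E) \<and>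
        ((\<lambda>\<omega>. L_core (X \<omega>) r (b \<omega>) (t \<omega>)) \<in> borel_measurable M \<and>
         (\<forall>\<omega>\<in>space M. ack_eligible (X \<omega>) r (b \<omega>)) \<longrightarrow>
           integrable M (\<lambda>\<omega>. L_core (X \<omega>) r (b \<omega>) (t \<omega>)) \<and>
           (\<integral>\<omega>. L_core (X \<omega>) r (b \<omega>) (t \<omega>) \<partial>M)
             \<le> delta E + delta E / 2 + 2 * delta E + delta E + 2 * delta E))"
proof (intro conjI)
  interpret responsive_run E r
    by unfold_locales (rule suffix)
  show "\<forall>a tx b t. places E a tx b t \<and> beta E r \<le> t \<longrightarrow>
        (tip_eligible E r b \<longrightarrow>
           sequenced_by E r UNIV named_refs b (t + 4 * delta E) \<and>
           L_tip E r b t \<le> delta E + delta E + 2 * delta E) \<and>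
        (tip_eligible E r b \<and> ack_eligible E r b \<longrightarrow>
           sequenced_by E r UNIV core_refs b (t + 7 * delta E) \<and>
           L_core E r b t \<le> delta E + delta E + 2 * delta E + delta E + 2 * delta E) \<and>
        (\<forall>v B k. prefix_extending E v \<and> proposes E v B k \<and> tm E k = t + delta E \<and>
           direct_pub E (proposer E v) (block_ref E b) k \<and> coverable E (proposer E v) b k \<longrightarrow>
           sequenced_by E r UNIV named_refs b (t + 3 * delta E)) \<and>
        (\<forall>u B k \<rho> w B' k'. proposes E u B k \<and> tm E k = t + delta E \<and>
           direct_pub E (proposer E u) (block_ref E b) k \<and> \<rho> \<in> snd B \<and> covers E \<rho> b \<and>
           prefix_extending E w \<and> proposes E w B' k' \<and> tm E k' = t + 3 * delta E \<and>
           ack_quorum E (proposer E w) u B \<rho> k' \<longrightarrow>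
           sequenced_by E r UNIV core_refs b (t + 5 * delta E) \<and>
           sequenced_by E r {Fast_Seal} core_refs b (t + 5 * delta E) \<and>
           sequenced_by E r {Ready_Path} core_refs b (t + 6 * delta E))"
  proof (intro allI impI conjI; elim conjE)
    fix a tx b t assume p: "places E a tx b t" "beta E r \<le> t" and tip: "tip_eligible E r b"
    show "sequenced_by E r UNIV named_refs b (t + 4 * delta E)"
      using worst_case_tip(1)[OF p tip] .
    show "L_tip E r b t \<le> delta E + delta E + 2 * delta E"
      using worst_case_tip(2)[OF p tip] by simp
    assume ack: "ack_eligible E r b"
    show "sequenced_by E r UNIV core_refs b (t + 7 * delta E)"
      using worst_case_core(1)[OF p tip ack] .
    show "L_core E r b t \<le> delta E + delta E + 2 * delta E + delta E + 2 * delta E"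
      using worst_case_core(2)[OF p tip ack] by simp
  next
    fix a tx b t v B k
    assume "places E a tx b t" "beta E r \<le> t" "prefix_extending E v" "proposes E v B k"
      "tm E k = t + delta E" "direct_pub E (proposer E v) (block_ref E b) k"
      "coverable E (proposer E v) b k"
    thus "sequenced_by E r UNIV named_refs b (t + 3 * delta E)"
      by (rule aligned_tip)
  next
    fix a tx b t u B k \<rho> w B' k'
    assume "places E a tx b t" "beta E r \<le> t" "proposes E u B k" "tm E k = t + delta E"
      "\<rho> \<in> snd B" "covers E \<rho> b" "prefix_extending E w" "proposes E w B' k'"
      "tm E k' = t + 3 * delta E" "ack_quorum E (proposer E w) u B \<rho> k'"
    \<comment> \<open>The premise \<open>seals_by\<close> stays open. Each goal fixes it: two delays
      after \<open>t + 3 * delta E\<close> for the fast seal, three for the READY path.\<close>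
    note core = aligned_core[OF this]
    show "sequenced_by E r UNIV core_refs b (t + 5 * delta E)"
      "sequenced_by E r {Fast_Seal} core_refs b (t + 5 * delta E)"
      "sequenced_by E r {Ready_Path} core_refs b (t + 6 * delta E)"
      by (rule core; simp add: seals_by_def)+
  qed
  show "\<forall>J. finite J \<and> J \<noteq> {} \<and> prob_space M \<and> e \<in> borel_measurable M \<and>
        distr M borel e = uniform_measure lborel (opportunity_intervals E r J) \<longrightarrow>
        integrable M (\<lambda>\<omega>. next_opportunity E r (e \<omega>) - e \<omega>) \<and>
        (\<integral>\<omega>. next_opportunity E r (e \<omega>) - e \<omega> \<partial>M) \<le> delta E / 2"
    using expected_wait by blast
  show "\<forall>J. finite J \<and> J \<noteq> {} \<and> prob_space M \<and> e \<in> borel_measurable M \<and>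
        distr M borel e = uniform_measure lborel (opportunity_intervals E r J) \<and>
        (\<forall>\<omega>\<in>space M. responsive_suffix (X \<omega>) r \<and> delta (X \<omega>) = delta E \<and>
           (\<forall>j. opportunity (X \<omega>) r j = opportunity E r j) \<and>
           places (X \<omega>) (a \<omega>) (tx \<omega>) (b \<omega>) (t \<omega>) \<and> beta (X \<omega>) r \<le> t \<omega> \<and>
           e \<omega> = eligibility (X \<omega>) (b \<omega>) \<and> tip_eligible (X \<omega>) r (b \<omega>)) \<longrightarrow>
        ((\<lambda>\<omega>. L_tip (X \<omega>) r (b \<omega>) (t \<omega>)) \<in> borel_measurable M \<longrightarrow>
           integrable M (\<lambda>\<omega>. L_tip (X \<omega>) r (b \<omega>) (t \<omega>)) \<and>
           (\<integral>\<omega>. L_tip (X \<omega>) r (b \<omega>) (t \<omega>) \<partial>M) \<le> delta E + delta E / 2 + 2 * delta E) \<and>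
        ((\<lambda>\<omega>. L_core (X \<omega>) r (b \<omega>) (t \<omega>)) \<in> borel_measurable M \<and>
         (\<forall>\<omega>\<in>space M. ack_eligible (X \<omega>) r (b \<omega>)) \<longrightarrow>
           integrable M (\<lambda>\<omega>. L_core (X \<omega>) r (b \<omega>) (t \<omega>)) \<and>
           (\<integral>\<omega>. L_core (X \<omega>) r (b \<omega>) (t \<omega>) \<partial>M)
             \<le> delta E + delta E / 2 + 2 * delta E + delta E + 2 * delta E)"
  proof (intro allI impI; elim conjE)
    fix J
    assume J: "finite J" "J \<noteq> {}" and M: "prob_space M" and e: "e \<in> borel_measurable M"
      and distr: "distr M borel e = uniform_measure lborel (opportunity_intervals E r J)"
      and X: "\<forall>\<omega>\<in>space M. responsive_suffix (X \<omega>) r \<and> delta (X \<omega>) = delta E \<and>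
           (\<forall>j. opportunity (X \<omega>) r j = opportunity E r j) \<and>
           places (X \<omega>) (a \<omega>) (tx \<omega>) (b \<omega>) (t \<omega>) \<and> beta (X \<omega>) r \<le> t \<omega> \<and>
           e \<omega> = eligibility (X \<omega>) (b \<omega>) \<and> tip_eligible (X \<omega>) r (b \<omega>)"
    interpret prob_space M
      by (rule M)
    note wait = expected_wait[OF J e distr]
    have latency: "0 \<le> L_tip (X \<omega>) r (b \<omega>) (t \<omega>)"
      "L_tip (X \<omega>) r (b \<omega>) (t \<omega>) \<le> next_opportunity E r (e \<omega>) - e \<omega> + 3 * delta E"
      "ack_eligible (X \<omega>) r (b \<omega>) \<Longrightarrow> 0 \<le> L_core (X \<omega>) r (b \<omega>) (t \<omega>)"
      "ack_eligible (X \<omega>) r (b \<omega>) \<Longrightarrow>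
        L_core (X \<omega>) r (b \<omega>) (t \<omega>) \<le> next_opportunity E r (e \<omega>) - e \<omega> + 6 * delta E"
      if \<omega>: "\<omega> \<in> space M" for \<omega>
      using latency_of_shared_schedule[of "X \<omega>" "a \<omega>" "tx \<omega>" "b \<omega>" "t \<omega>"] bspec[OF X \<omega>] by simp_all
    show "((\<lambda>\<omega>. L_tip (X \<omega>) r (b \<omega>) (t \<omega>)) \<in> borel_measurable M \<longrightarrow>
           integrable M (\<lambda>\<omega>. L_tip (X \<omega>) r (b \<omega>) (t \<omega>)) \<and>
           (\<integral>\<omega>. L_tip (X \<omega>) r (b \<omega>) (t \<omega>) \<partial>M) \<le> delta E + delta E / 2 + 2 * delta E) \<and>
        ((\<lambda>\<omega>. L_core (X \<omega>) r (b \<omega>) (t \<omega>)) \<in> borel_measurable M \<and>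
         (\<forall>\<omega>\<in>space M. ack_eligible (X \<omega>) r (b \<omega>)) \<longrightarrow>
           integrable M (\<lambda>\<omega>. L_core (X \<omega>) r (b \<omega>) (t \<omega>)) \<and>
           (\<integral>\<omega>. L_core (X \<omega>) r (b \<omega>) (t \<omega>) \<partial>M)
             \<le> delta E + delta E / 2 + 2 * delta E + delta E + 2 * delta E)"
    proof (intro conjI impI; (elim conjE)?)
      assume f: "(\<lambda>\<omega>. L_tip (X \<omega>) r (b \<omega>) (t \<omega>)) \<in> borel_measurable M"
      note tip = expectation_le_shift[OF f wait, of "3 * delta E"]
      show "integrable M (\<lambda>\<omega>. L_tip (X \<omega>) r (b \<omega>) (t \<omega>))"
        using tip(1) latency(1,2) by blast
      show "(\<integral>\<omega>. L_tip (X \<omega>) r (b \<omega>) (t \<omega>) \<partial>M) \<le> delta E + delta E / 2 + 2 * delta E"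
        using tip(2) latency(1,2) by fastforce
    next
      assume f: "(\<lambda>\<omega>. L_core (X \<omega>) r (b \<omega>) (t \<omega>)) \<in> borel_measurable M"
        and ack: "\<forall>\<omega>\<in>space M. ack_eligible (X \<omega>) r (b \<omega>)"
      note core = expectation_le_shift[OF f wait, of "6 * delta E"]
      show "integrable M (\<lambda>\<omega>. L_core (X \<omega>) r (b \<omega>) (t \<omega>))"
        using core(1) latency(3,4) ack by blast
      show "(\<integral>\<omega>. L_core (X \<omega>) r (b \<omega>) (t \<omega>) \<partial>M)
          \<le> delta E + delta E / 2 + 2 * delta E + delta E + 2 * delta E"
        using core(2) latency(3,4) ack by fastforce
    qed
  qed
qed

end
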